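(* Let $X$ be a Lindelöf space, $\mu$ a Borel measure on $X$ and $E$ a Hermitian vector bundle over $X$. Assume that $\mathfrak{b}$ is a closed form in $L^2(X,\mu)$ satisfying the first Beurling-Deny criterion and that $\mathfrak{a}$ is a closed form in $L^2(X,\mu;E)$ that is dominated by $\mathfrak{b}$. If $D(\mathfrak{b})\cap L^2_c(X,\mu)$ is a core for $\mathfrak{b}$, then $D(\mathfrak{a})\cap L^2_c(X,\mu;E)$ is a core for $\mathfrak{a}$.
   Context: A Lindelöf space is a topological space in which every open cover has a countable subcover. A Hermitian vector bundle over $X$ is a topological space $E$ with a continuous surjection $\pi\colon E\to X$ such that each fiber $\pi^{-1}(x)$ is a finite-dimensional complex vector space with inner product $\langle\cdot,\cdot\rangle_x$ (norm $|\cdot|_x$), and there is a finite-dimensional complex Hilbert space $H$ such that each point of $X$ has a neighborhood $U$ and a homeomorphism $\varphi\colon U\times H\to\pi^{-1}(U)$ for which $\varphi(x,\cdot)$ is an isometric isomorphism from $H$ onto $\pi^{-1}(x)$ for each $x\in U$. A section is a map $\xi\colon X\to E$ with $\pi\circ\xi=\mathrm{id}_X$. $L^2(X,\mu;E)$ is the Hilbert space of ($\mu$-a.e. classes of) Borel measurable sections $\xi$ with $\int_X|\xi(x)|_x^2\,d\mu(x)<\infty$. $L^2_c(X,\mu)$ and $L^2_c(X,\mu;E)$ are the spaces of square integrable functions, respectively sections, that vanish outside a compact set. All Hilbert spaces are complex. A quadratic form $q$ on a Hilbert space is given on a dense subspace $D(q)$, takes real values, and is identified with the sesquilinear form it induces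 by polarization, $q(f,g)=\frac14\sum_{k=1}^4 i^kq(f+i^kg)$. It is lower bounded if $q(f)\ge-\lambda\|f\|^2$ on $D(q)$ for some $\lambda\in\mathbb{R}$; the form norm is $\|f\|_q=(q(f)+\mu_0\|f\|^2)^{1/2}$ for a fixed $\mu_0>\lambda$. A closed form is a lower bounded form for which $(D(q),\|\cdot\|_q)$ is complete. A core for $q$ is a subspace of $D(q)$ dense with respect to $\|\cdot\|_q$. A form $q$ on $L^2(X,\mu)$ is real if $f\in D(q)$ implies $\bar f\in D(q)$ and $q(\bar f)=q(f)$; a real form satisfies the first Beurling-Deny criterion if $f\in D(q)$ implies $|f|\in D(q)$ and $q(|f|)\le q(f)$. For $\xi\in L^2(X,\mu;E)$ put $|\xi|(x)=|\xi(x)|_x$, a nonnegative element of $L^2(X,\mu)$. Two elements $\xi,\eta\in L^2(X,\mu;E)$ are paired if $\langle\xi,\eta\rangle=\langle|\xi|,|\eta|\rangle$. The form $\mathfrak{a}$ is dominated by $\mathfrak{b}$ if (a) $D(\mathfrak{a})$ is a generalized ideal of $D(\mathfrak{b})$, i.e. for all $\xi\in D(\mathfrak{a})$ one has $|\xi|\in D(\mathfrak{b})$ and for every $f\in D(\mathfrak{b})$ with $0\le f\le|\xi|$ there is $\eta\in D(\mathfrak{a})$ with $|\eta|=f$ and $\xi,\eta$ paired; and (b) $\operatorname{Re}\mathfrak{a}(\xi,\eta)\ge\mathfrak{b}(|\xi|,|\eta|)$ whenever $\xi,\eta\in D(\mathfrak{a})$ are paired. *)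

theory Defs
  imports "HOL-Analysis.Analysis"
begin

section \<open>Complex inner product spaces on explicit carriers\<close>

text \<open>
  The fibres of a vector bundle are subsets of one type, so the vector space structure is carried
  by a record. The inner product is linear in the \<^emph>\<open>first\<close> argument, in accordance with the
  polarization formula used below.
\<close>

record 'v inner_structure =
  vecs :: "'v set"
  vzero :: 'v
  vadd :: "'v \<Rightarrow> 'v \<Rightarrow> 'v"
  vscale :: "complex \<Rightarrow> 'v \<Rightarrow> 'v"
  vinner :: "'v \<Rightarrow> 'v \<Rightarrow> complex"

locale complex_inner_space =
  fixes V :: "'v inner_structure"
  assumes zero_closed: "vzero V \<in> vecs V"
    and add_closed: "\<lbrakk>u \<in> vecs V; v \<in> vecs V\<rbrakk> \<Longrightarrow> vadd V u v \<in> vecs V"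
    and scale_closed: "u \<in> vecs V \<Longrightarrow> vscale V c u \<in> vecs V"
    and add_assoc: "\<lbrakk>u \<in> vecs V; v \<in> vecs V; w \<in> vecs V\<rbrakk>
          \<Longrightarrow> vadd V (vadd V u v) w = vadd V u (vadd V v w)"
    and add_commute: "\<lbrakk>u \<in> vecs V; v \<in> vecs V\<rbrakk> \<Longrightarrow> vadd V u v = vadd V v u"
    and add_zero: "u \<in> vecs V \<Longrightarrow> vadd V u (vzero V) = u"
    and add_inverse: "u \<in> vecs V \<Longrightarrow> \<exists>v\<in>vecs V. vadd V u v = vzero V"
    and scale_one: "u \<in> vecs V \<Longrightarrow> vscale V 1 u = u"
    and scale_scale: "u \<in> vecs V \<Longrightarrow> vscale V c (vscale V d u) = vscale V (c * d) u"
    and scale_add_right: "\<lbrakk>u \<in> vecs V; v \<in> vecs V\<rbrakk>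
          \<Longrightarrow> vscale V c (vadd V u v) = vadd V (vscale V c u) (vscale V c v)"
    and scale_add_left: "u \<in> vecs V
          \<Longrightarrow> vscale V (c + d) u = vadd V (vscale V c u) (vscale V d u)"
    and inner_add: "\<lbrakk>u \<in> vecs V; v \<in> vecs V; w \<in> vecs V\<rbrakk>
          \<Longrightarrow> vinner V (vadd V u v) w = vinner V u w + vinner V v w"
    and inner_scale: "\<lbrakk>u \<in> vecs V; v \<in> vecs V\<rbrakk> \<Longrightarrow> vinner V (vscale V c u) v = c * vinner V u v"
    and inner_commute: "\<lbrakk>u \<in> vecs V; v \<in> vecs V\<rbrakk> \<Longrightarrow> vinner V v u = cnj (vinner V u v)"
    and inner_nonneg: "u \<in> vecs V \<Longrightarrow> 0 \<le> Re (vinner V u u)"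
    and inner_definite: "\<lbrakk>u \<in> vecs V; vinner V u u = 0\<rbrakk> \<Longrightarrow> u = vzero V"

definition vnorm :: "'v inner_structure \<Rightarrow> 'v \<Rightarrow> real" where
  "vnorm V u = sqrt (Re (vinner V u u))"

definition vdiff :: "'v inner_structure \<Rightarrow> 'v \<Rightarrow> 'v \<Rightarrow> 'v" where
  "vdiff V u v = vadd V u (vscale V (- 1) v)"

text \<open>
  The value off the carrier is irrelevant for the topology; it is set to \<open>0\<close> because \<^locale>\<open>Metric_space\<close>
  requires nonnegativity and symmetry on the whole type.
\<close>

definition vdist :: "'v inner_structure \<Rightarrow> 'v \<Rightarrow> 'v \<Rightarrow> real" where
  "vdist V u v = (if u \<in> vecs V \<and> v \<in> vecs V then vnorm V (vdiff V u v) else 0)"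

definition norm_topology :: "'v inner_structure \<Rightarrow> 'v topology" where
  "norm_topology V = Metric_space.mtopology (vecs V) (vdist V)"

definition linear_subspace :: "'v inner_structure \<Rightarrow> 'v set \<Rightarrow> bool" where
  "linear_subspace V S \<longleftrightarrow> S \<subseteq> vecs V \<and> vzero V \<in> S \<and>
     (\<forall>u\<in>S. \<forall>v\<in>S. vadd V u v \<in> S) \<and> (\<forall>c. \<forall>u\<in>S. vscale V c u \<in> S)"

definition finite_dimensional :: "'v inner_structure \<Rightarrow> bool" where
  "finite_dimensional V \<longleftrightarrow>
     (\<exists>B. finite B \<and> B \<subseteq> vecs V \<and> (\<forall>S. linear_subspace V S \<and> B \<subseteq> S \<longrightarrow> S = vecs V))"

definition isometric_isomorphism ::
    "'v inner_structure \<Rightarrow> 'w inner_structure \<Rightarrow> ('v \<Rightarrow> 'w) \<Rightarrow> bool" where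
  "isometric_isomorphism V W f \<longleftrightarrow> bij_betw f (vecs V) (vecs W) \<and>
     (\<forall>u\<in>vecs V. \<forall>v\<in>vecs V. f (vadd V u v) = vadd W (f u) (f v)) \<and>
     (\<forall>c. \<forall>u\<in>vecs V. f (vscale V c u) = vscale W c (f u)) \<and>
     (\<forall>u\<in>vecs V. vnorm W (f u) = vnorm V u)"

definition complex_line :: "complex inner_structure" where
  "complex_line = \<lparr>vecs = UNIV, vzero = 0, vadd = (+), vscale = (*), vinner = (\<lambda>z w. z * cnj w)\<rparr>"

lemma vnorm_complex_line: "vnorm complex_line z = cmod z"
  by (simp add: vnorm_def complex_line_def cmod_def power2_eq_square)


section \<open>Hermitian vector bundles\<close>

record ('x, 'e) vbundle =
  total_space :: "'e topology"
  proj :: "'e \<Rightarrow> 'x"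
  fibre :: "'x \<Rightarrow> 'e inner_structure"

text \<open>
  The model space \<open>H\<close> is a finite-dimensional inner product space, hence automatically complete.
  It may have any dimension, including \<open>0\<close>. The neighbourhood \<open>U\<close> need not be open.
\<close>

locale hermitian_vector_bundle =
  fixes X :: "'x topology" and E :: "('x, 'e) vbundle" and H :: "'h inner_structure"
  assumes proj_continuous: "continuous_map (total_space E) X (proj E)"
    and proj_surjective: "proj E ` topspace (total_space E) = topspace X"
    and fibre_carrier: "x \<in> topspace X
          \<Longrightarrow> vecs (fibre E x) = {e \<in> topspace (total_space E). proj E e = x}"
    and fibre_inner_space: "x \<in> topspace X \<Longrightarrow> complex_inner_space (fibre E x)"
    and fibre_finite_dimensional: "x \<in> topspace X \<Longrightarrow> finite_dimensional (fibre E x)"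
    and model_inner_space: "complex_inner_space H"
    and model_finite_dimensional: "finite_dimensional H"
    and locally_trivial: "x \<in> topspace X \<Longrightarrow>
          \<exists>U \<phi>. U \<subseteq> topspace X \<and> (\<exists>W. openin X W \<and> x \<in> W \<and> W \<subseteq> U) \<and>
            homeomorphic_map (prod_topology (subtopology X U) (norm_topology H))
              (subtopology (total_space E) {e \<in> topspace (total_space E). proj E e \<in> U}) \<phi> \<and>
            (\<forall>y\<in>U. isometric_isomorphism H (fibre E y) (\<lambda>h. \<phi> (y, h)))"


section \<open>Spaces of square integrable functions and sections\<close>

definition borel_of :: "'x topology \<Rightarrow> 'x measure" where
  "borel_of X = sigma (topspace X) {U. openin X U}"

definition ae_class :: "'x measure \<Rightarrow> ('x \<Rightarrow> 'e) set \<Rightarrow> ('x \<Rightarrow> 'e) \<Rightarrow> ('x \<Rightarrow> 'e) set" where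
  "ae_class M S f = {g \<in> S. AE x in M. g x = f x}"

definition rep :: "'a set \<Rightarrow> 'a" where
  "rep A = (SOME f. f \<in> A)"

text \<open>
  The structure of a.e. classes of elements of \<open>S\<close>, where \<open>S\<close> is a set of maps whose value at \<open>x\<close>
  lies in the inner product space \<open>F x\<close>.
\<close>

definition class_space ::
    "'x measure \<Rightarrow> ('x \<Rightarrow> 'e inner_structure) \<Rightarrow> ('x \<Rightarrow> 'e) set \<Rightarrow> ('x \<Rightarrow> 'e) set inner_structure" where
  "class_space M F S =
    \<lparr>vecs = ae_class M S ` S,
     vzero = ae_class M S (\<lambda>x. vzero (F x)),
     vadd = (\<lambda>A B. ae_class M S (\<lambda>x. vadd (F x) (rep A x) (rep B x))),
     vscale = (\<lambda>c A. ae_class M S (\<lambda>x. vscale (F x) c (rep A x))),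
     vinner = (\<lambda>A B. \<integral>x. vinner (F x) (rep A x) (rep B x) \<partial>M)\<rparr>"

definition sq_integrable_functions :: "'x measure \<Rightarrow> ('x \<Rightarrow> complex) set" where
  "sq_integrable_functions M =
     {f \<in> borel_measurable M. integrable M (\<lambda>x. (cmod (f x))\<^sup>2)}"

definition L2 :: "'x measure \<Rightarrow> ('x \<Rightarrow> complex) set inner_structure" where
  "L2 M = class_space M (\<lambda>_. complex_line) (sq_integrable_functions M)"

definition sq_integrable_sections :: "'x measure \<Rightarrow> ('x, 'e) vbundle \<Rightarrow> ('x \<Rightarrow> 'e) set" where
  "sq_integrable_sections M E =
     {\<xi> \<in> measurable M (borel_of (total_space E)).
        (\<forall>x\<in>space M. proj E (\<xi> x) = x) \<and> integrable M (\<lambda>x. (vnorm (fibre E x) (\<xi> x))\<^sup>2)}"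

definition L2_sections :: "'x measure \<Rightarrow> ('x, 'e) vbundle \<Rightarrow> ('x \<Rightarrow> 'e) set inner_structure" where
  "L2_sections M E = class_space M (fibre E) (sq_integrable_sections M E)"

definition L2_compact :: "'x topology \<Rightarrow> 'x measure \<Rightarrow> ('x \<Rightarrow> complex) set set" where
  "L2_compact X M = {A \<in> vecs (L2 M).
     \<exists>K. compactin X K \<and> (\<exists>f\<in>A. \<forall>x\<in>topspace X - K. f x = 0)}"

definition L2_sections_compact ::
    "'x topology \<Rightarrow> 'x measure \<Rightarrow> ('x, 'e) vbundle \<Rightarrow> ('x \<Rightarrow> 'e) set set" where
  "L2_sections_compact X M E = {A \<in> vecs (L2_sections M E).
     \<exists>K. compactin X K \<and> (\<exists>\<xi>\<in>A. \<forall>x\<in>topspace X - K. \<xi> x = vzero (fibre E x))}"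

definition L2_cnj :: "'x measure \<Rightarrow> ('x \<Rightarrow> complex) set \<Rightarrow> ('x \<Rightarrow> complex) set" where
  "L2_cnj M A = ae_class M (sq_integrable_functions M) (\<lambda>x. cnj (rep A x))"

definition L2_abs :: "'x measure \<Rightarrow> ('x \<Rightarrow> complex) set \<Rightarrow> ('x \<Rightarrow> complex) set" where
  "L2_abs M A = ae_class M (sq_integrable_functions M) (\<lambda>x. complex_of_real (cmod (rep A x)))"

definition section_abs ::
    "'x measure \<Rightarrow> ('x, 'e) vbundle \<Rightarrow> ('x \<Rightarrow> 'e) set \<Rightarrow> ('x \<Rightarrow> complex) set" where
  "section_abs M E A = ae_class M (sq_integrable_functions M)
     (\<lambda>x. complex_of_real (vnorm (fibre E x) (rep A x)))"

text \<open>
  The order on \<open>L\<^sup>2\<close>: \<open>A \<le> B\<close> iff \<open>B - A\<close> is a.e. real and nonnegative.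
\<close>

definition L2_le :: "'x measure \<Rightarrow> ('x \<Rightarrow> complex) set \<Rightarrow> ('x \<Rightarrow> complex) set \<Rightarrow> bool" where
  "L2_le M A B \<longleftrightarrow>
     (AE x in M. Re (rep A x) \<le> Re (rep B x) \<and> Im (rep A x) = Im (rep B x))"


section \<open>Quadratic forms\<close>

record 'v qform =
  fdom :: "'v set"
  fval :: "'v \<Rightarrow> real"

definition polar :: "'v inner_structure \<Rightarrow> 'v qform \<Rightarrow> 'v \<Rightarrow> 'v \<Rightarrow> complex" where
  "polar V q u v =
     (1/4) * (\<Sum>k=1..4. \<i> ^ k * complex_of_real (fval q (vadd V u (vscale V (\<i> ^ k) v))))"

locale quadratic_form =
  fixes V :: "'v inner_structure" and q :: "'v qform"
  assumes dom_subspace: "linear_subspace V (fdom q)"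
    and dom_dense: "\<lbrakk>u \<in> vecs V; \<epsilon> > 0\<rbrakk> \<Longrightarrow> \<exists>v\<in>fdom q. vnorm V (vdiff V u v) < \<epsilon>"
    and polar_add_left: "\<lbrakk>u \<in> fdom q; v \<in> fdom q; w \<in> fdom q\<rbrakk>
          \<Longrightarrow> polar V q (vadd V u v) w = polar V q u w + polar V q v w"
    and polar_add_right: "\<lbrakk>u \<in> fdom q; v \<in> fdom q; w \<in> fdom q\<rbrakk>
          \<Longrightarrow> polar V q u (vadd V v w) = polar V q u v + polar V q u w"
    and polar_scale_left: "\<lbrakk>u \<in> fdom q; v \<in> fdom q\<rbrakk>
          \<Longrightarrow> polar V q (vscale V c u) v = c * polar V q u v"
    and polar_scale_right: "\<lbrakk>u \<in> fdom q; v \<in> fdom q\<rbrakk>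
          \<Longrightarrow> polar V q u (vscale V c v) = cnj c * polar V q u v"
    and polar_diagonal: "u \<in> fdom q \<Longrightarrow> polar V q u u = complex_of_real (fval q u)"

definition lower_bound :: "'v inner_structure \<Rightarrow> 'v qform \<Rightarrow> real \<Rightarrow> bool" where
  "lower_bound V q l \<longleftrightarrow> (\<forall>u\<in>fdom q. fval q u \<ge> - l * (vnorm V u)\<^sup>2)"

definition form_norm :: "'v inner_structure \<Rightarrow> 'v qform \<Rightarrow> real \<Rightarrow> 'v \<Rightarrow> real" where
  "form_norm V q m u = sqrt (fval q u + m * (vnorm V u)\<^sup>2)"

text \<open>
  \<open>m\<close> is the constant \<open>\<mu>\<^sub>0 > \<lambda>\<close> fixed in the definition of the form norm. All admissible choices give
  equivalent norms.
\<close>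

definition closed_form :: "'v inner_structure \<Rightarrow> 'v qform \<Rightarrow> real \<Rightarrow> bool" where
  "closed_form V q m \<longleftrightarrow> quadratic_form V q \<and> (\<exists>l<m. lower_bound V q l) \<and>
     (\<forall>u :: nat \<Rightarrow> 'v.
        (\<forall>n. u n \<in> fdom q) \<and>
        (\<forall>\<epsilon>>0. \<exists>N. \<forall>i\<ge>N. \<forall>j\<ge>N. form_norm V q m (vdiff V (u i) (u j)) < \<epsilon>) \<longrightarrow>
        (\<exists>v\<in>fdom q. (\<lambda>n. form_norm V q m (vdiff V (u n) v)) \<longlonglongrightarrow> 0))"

definition form_core :: "'v inner_structure \<Rightarrow> 'v qform \<Rightarrow> real \<Rightarrow> 'v set \<Rightarrow> bool" where
  "form_core V q m S \<longleftrightarrow> linear_subspace V S \<and> S \<subseteq> fdom q \<and>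
     (\<forall>u\<in>fdom q. \<forall>\<epsilon>>0. \<exists>v\<in>S. form_norm V q m (vdiff V u v) < \<epsilon>)"

definition real_form :: "'x measure \<Rightarrow> ('x \<Rightarrow> complex) set qform \<Rightarrow> bool" where
  "real_form M b \<longleftrightarrow> (\<forall>f\<in>fdom b. L2_cnj M f \<in> fdom b \<and> fval b (L2_cnj M f) = fval b f)"

definition first_Beurling_Deny :: "'x measure \<Rightarrow> ('x \<Rightarrow> complex) set qform \<Rightarrow> bool" where
  "first_Beurling_Deny M b \<longleftrightarrow> real_form M b \<and>
     (\<forall>f\<in>fdom b. L2_abs M f \<in> fdom b \<and> fval b (L2_abs M f) \<le> fval b f)"


section \<open>Domination\<close>

definition paired ::
    "'x measure \<Rightarrow> ('x, 'e) vbundle \<Rightarrow> ('x \<Rightarrow> 'e) set \<Rightarrow> ('x \<Rightarrow> 'e) set \<Rightarrow> bool" where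
  "paired M E \<xi> \<eta> \<longleftrightarrow>
     vinner (L2_sections M E) \<xi> \<eta> = vinner (L2 M) (section_abs M E \<xi>) (section_abs M E \<eta>)"

definition generalized_ideal ::
    "'x measure \<Rightarrow> ('x, 'e) vbundle \<Rightarrow> ('x \<Rightarrow> 'e) set set \<Rightarrow> ('x \<Rightarrow> complex) set set \<Rightarrow> bool" where
  "generalized_ideal M E Da Db \<longleftrightarrow>
     (\<forall>\<xi>\<in>Da. section_abs M E \<xi> \<in> Db \<and>
        (\<forall>f\<in>Db. L2_le M (vzero (L2 M)) f \<and> L2_le M f (section_abs M E \<xi>) \<longrightarrow>
           (\<exists>\<eta>\<in>Da. section_abs M E \<eta> = f \<and> paired M E \<xi> \<eta>)))"

text \<open>
  The value of the form \<open>b\<close> at a pair of real functions is a real number when \<open>b\<close> is a real form, so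
  that taking its real part below changes nothing.
\<close>

definition dominated ::
    "'x measure \<Rightarrow> ('x, 'e) vbundle \<Rightarrow> ('x \<Rightarrow> 'e) set qform \<Rightarrow> ('x \<Rightarrow> complex) set qform \<Rightarrow> bool" where
  "dominated M E a b \<longleftrightarrow> generalized_ideal M E (fdom a) (fdom b) \<and>
     (\<forall>\<xi>\<in>fdom a. \<forall>\<eta>\<in>fdom a. paired M E \<xi> \<eta> \<longrightarrow>
        Re (polar (L2_sections M E) a \<xi> \<eta>)
          \<ge> Re (polar (L2 M) b (section_abs M E \<xi>) (section_abs M E \<eta>)))"

end

theory Submission
  imports Defs
begin

text \<open>
  Let \<open>\<xi>\<close> be in the domain of \<open>a\<close> and \<open>u = |\<xi>|\<close>. The core hypothesis yields a compactly supported \<open>g\<close>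
  close to \<open>u\<close> in the form norm of \<open>b\<close>. The first Beurling-Deny criterion puts
  \<open>f = min |g| u = (|g| + u - ||g| - u|) / 2\<close> into the domain of \<open>b\<close>, with a form norm controlled by
  those of \<open>g\<close> and \<open>u\<close> (\<open>min_abs_in_domain\<close>). As \<open>0 \<le> f \<le> |\<xi>|\<close>, the generalized ideal property supplies
  \<open>\<eta>\<close> in the domain of \<open>a\<close>, paired with \<open>\<xi>\<close>, with \<open>|\<eta>| = f\<close>; morally \<open>\<eta> = f \<xi> / |\<xi>|\<close>. It vanishes
  almost everywhere where \<open>g\<close> does, so it has compact support.

  Being paired is a pointwise condition (\<open>paired_iff_AE\<close>), namely equality in the Cauchy-Schwarz
  inequality in almost every fibre. Hence \<open>\<xi> - \<eta>\<close> and \<open>\<eta>\<close> are paired as well, and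
  \<open>|\<xi> - \<eta>| = u - f \<le> |u - g|\<close> (\<open>truncation\<close>). This has two consequences. First, \<open>\<eta>\<close> is as close to \<open>\<xi>\<close>
  in \<open>L\<^sup>2\<close> as \<open>g\<close> is to \<open>u\<close>. Second, domination gives \<open>Re a(\<xi> - \<eta>, \<eta>) \<ge> Re b(u - f, f)\<close>, that is,
  up to \<open>L\<^sup>2\<close> terms \<open>\<parallel>\<eta>\<parallel>\<^sup>2 \<le> \<parallel>\<xi>\<parallel> \<parallel>\<eta>\<parallel> + C\<close> in the form norm of \<open>a\<close>, where \<open>C\<close> is controlled by
  the form norms of \<open>u - f\<close> and \<open>f\<close> for \<open>b\<close> (\<open>truncation_form_bound\<close>). So the truncations stay
  bounded in the form norm while they converge to \<open>\<xi>\<close> in \<open>L\<^sup>2\<close>.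

  For a closed form this is enough (\<open>approximation_from_bounded\<close>): among the compactly supported
  elements in smaller and smaller \<open>L\<^sup>2\<close> balls around \<open>\<xi>\<close>, those of almost minimal form norm are a Cauchy
  sequence by the parallelogram law, and its limit can only be \<open>\<xi>\<close>.

  The Lindelof property makes the functions \<open>x \<mapsto> \<langle>\<xi>(x), \<eta>(x)\<rangle>\<close> measurable: over a trivializing open set
  they are finite sums of products of coordinates, and countably many such sets cover the space
  (\<open>section_inner_measurable\<close>). Measurable representatives of sums are supplied by the form domains:
  these are subspaces of \<open>L\<^sup>2\<close>, so the class of a sum of two of their elements is again an element of
  \<open>L\<^sup>2\<close>. For this reason the laws of an inner product space are established on subspaces of the
  spaces of classes (\<open>complex_inner_space_class\<close>).
\<close>


section \<open>Geometry of complex inner product spaces\<close>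

context complex_inner_space
begin

lemma scale_zero_left: "u \<in> vecs V \<Longrightarrow> vscale V 0 u = vzero V"
proof -
  assume u: "u \<in> vecs V"
  let ?z = "vscale V 0 u"
  have z: "?z \<in> vecs V" by (rule scale_closed[OF u])
  have zz: "vadd V ?z ?z = ?z"
    using scale_add_left[OF u, of 0 0] by simp
  obtain w where w: "w \<in> vecs V" "vadd V ?z w = vzero V"
    using add_inverse[OF z] by blast
  have "vadd V ?z (vadd V ?z w) = vadd V ?z w"
    using add_assoc[OF z z w(1)] zz by simp
  then show ?thesis using w add_zero[OF z] by simp
qed

lemma scale_zero_right: "vscale V c (vzero V) = vzero V"
  using scale_scale[OF zero_closed, of c 0] scale_zero_left[OF zero_closed] by simp

lemma diff_closed: "\<lbrakk>u \<in> vecs V; v \<in> vecs V\<rbrakk> \<Longrightarrow> vdiff V u v \<in> vecs V"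
  by (simp add: vdiff_def add_closed scale_closed)

lemma inner_add_right:
  "\<lbrakk>u \<in> vecs V; v \<in> vecs V; w \<in> vecs V\<rbrakk>
    \<Longrightarrow> vinner V u (vadd V v w) = vinner V u v + vinner V u w"
  using inner_commute[of u "vadd V v w"] inner_commute[of u v] inner_commute[of u w]
    inner_add[of v w u] add_closed[of v w]
  by (metis complex_cnj_add complex_cnj_cnj)

lemma inner_scale_right:
  "\<lbrakk>u \<in> vecs V; v \<in> vecs V\<rbrakk> \<Longrightarrow> vinner V u (vscale V c v) = cnj c * vinner V u v"
  using inner_commute[of u "vscale V c v"] inner_commute[of u v] inner_scale[of v u c]
    scale_closed[of v c]
  by (metis complex_cnj_mult complex_cnj_cnj)

lemma inner_diff:
  "\<lbrakk>u \<in> vecs V; v \<in> vecs V; w \<in> vecs V\<rbrakk>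
    \<Longrightarrow> vinner V (vdiff V u v) w = vinner V u w - vinner V v w"
  by (simp add: vdiff_def inner_add scale_closed inner_scale)

lemma inner_zero: "u \<in> vecs V \<Longrightarrow> vinner V (vzero V) u = 0"
  using inner_scale[OF zero_closed, of u 0] scale_zero_left[OF zero_closed] by simp

lemma vnorm_nonneg: "u \<in> vecs V \<Longrightarrow> 0 \<le> vnorm V u"
  by (simp add: vnorm_def inner_nonneg)

lemma vnorm_sq: "u \<in> vecs V \<Longrightarrow> (vnorm V u)\<^sup>2 = Re (vinner V u u)"
  by (simp add: vnorm_def inner_nonneg)

lemma inner_self: "u \<in> vecs V \<Longrightarrow> vinner V u u = of_real ((vnorm V u)\<^sup>2)"
  using inner_commute[of u u] by (simp add: vnorm_sq complex_eq_iff)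

lemma vnorm_zero: "vnorm V (vzero V) = 0"
  by (simp add: vnorm_def inner_zero zero_closed)

lemma vnorm_eq_zero: "u \<in> vecs V \<Longrightarrow> vnorm V u = 0 \<longleftrightarrow> u = vzero V"
  using inner_self[of u] inner_definite[of u] vnorm_zero by auto

lemma vnorm_add_scale_sq:
  assumes "u \<in> vecs V" "v \<in> vecs V"
  shows "(vnorm V (vadd V u (vscale V c v)))\<^sup>2
    = (vnorm V u)\<^sup>2 + 2 * Re (cnj c * vinner V u v) + (cmod c)\<^sup>2 * (vnorm V v)\<^sup>2"
proof -
  have "vinner V (vadd V u (vscale V c v)) (vadd V u (vscale V c v))
    = vinner V u u + cnj c * vinner V u v + c * cnj (vinner V u v) + (c * cnj c) * vinner V v v"
    using assms inner_commute[of u v]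
    by (simp add: inner_add inner_add_right inner_scale inner_scale_right add_closed scale_closed
        algebra_simps)
  moreover have "Re (c * cnj (vinner V u v)) = Re (cnj c * vinner V u v)"
    by simp
  moreover have "Re ((c * cnj c) * vinner V v v) = (cmod c)\<^sup>2 * (vnorm V v)\<^sup>2"
    using assms by (simp add: inner_self complex_mult_cnj cmod_power2)
  ultimately show ?thesis
    using assms by (simp add: vnorm_sq add_closed scale_closed)
qed

lemma vnorm_scale:
  assumes "u \<in> vecs V"
  shows "vnorm V (vscale V c u) = cmod c * vnorm V u"
proof -
  have "vinner V (vscale V c u) (vscale V c u) = of_real ((cmod c)\<^sup>2) * vinner V u u"
    using assms by (simp add: scale_closed inner_scale inner_scale_right complex_norm_square del: of_real_power)
  then show ?thesis
    by (simp add: vnorm_def real_sqrt_mult)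
qed

lemma vnorm_add_sq:
  assumes "u \<in> vecs V" "v \<in> vecs V"
  shows "(vnorm V (vadd V u v))\<^sup>2 = (vnorm V u)\<^sup>2 + 2 * Re (vinner V u v) + (vnorm V v)\<^sup>2"
  using vnorm_add_scale_sq[OF assms, of 1] assms by (simp add: scale_one)

lemma vnorm_diff_sq:
  assumes "u \<in> vecs V" "v \<in> vecs V"
  shows "(vnorm V (vdiff V u v))\<^sup>2 = (vnorm V u)\<^sup>2 - 2 * Re (vinner V u v) + (vnorm V v)\<^sup>2"
  using vnorm_add_scale_sq[OF assms, of "- 1"] by (simp add: vdiff_def)

text \<open>
  The law is stated with the midpoint of \<open>u\<close> and \<open>v\<close>, which lies in every convex set that contains
  both; this is how a sequence of almost minimizers is shown to be Cauchy.
\<close>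

lemma parallelogram:
  assumes "u \<in> vecs V" "v \<in> vecs V"
  shows "(vnorm V (vdiff V u v))\<^sup>2
    = 2 * (vnorm V u)\<^sup>2 + 2 * (vnorm V v)\<^sup>2 - 4 * (vnorm V (vscale V (1/2) (vadd V u v)))\<^sup>2"
  using assms by (simp add: vnorm_scale add_closed vnorm_diff_sq vnorm_add_sq power_mult_distrib
      power_divide field_simps)

lemma midpoint_diff:
  assumes "u \<in> vecs V" "v \<in> vecs V" "w \<in> vecs V"
  shows "vdiff V u (vscale V (1/2) (vadd V v w))
    = vscale V (1/2) (vadd V (vdiff V u v) (vdiff V u w))"
proof -
  let ?v = "vscale V (- 1) v" and ?w = "vscale V (- 1) w"
  have vw: "?v \<in> vecs V" "?w \<in> vecs V" using assms by (simp_all add: scale_closed)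
  have "vadd V (vadd V u ?v) (vadd V u ?w) = vadd V u (vadd V (vadd V ?v u) ?w)"
    using assms vw by (simp add: add_assoc add_closed)
  also have "\<dots> = vadd V (vadd V u u) (vadd V ?v ?w)"
    using assms vw by (simp add: add_commute[OF vw(1) assms(1)] add_assoc add_closed)
  finally have sum: "vadd V (vadd V u ?v) (vadd V u ?w) = vadd V (vadd V u u) (vadd V ?v ?w)" .
  have "vscale V (1/2) (vadd V u u) = u"
    using assms(1) scale_add_left[OF assms(1), of "1/2" "1/2"]
    by (simp add: scale_add_right scale_one)
  moreover have "vscale V (1/2) (vadd V ?v ?w) = vscale V (- 1) (vscale V (1/2) (vadd V v w))"
    using assms by (simp add: scale_scale add_closed scale_closed flip: scale_add_right)
  ultimately show ?thesis
    unfolding vdiff_def sum using assms vw by (simp add: scale_add_right add_closed)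
qed

lemma Cauchy_Schwarz:
  assumes u: "u \<in> vecs V" and v: "v \<in> vecs V"
  shows "cmod (vinner V u v) \<le> vnorm V u * vnorm V v"
proof (cases "vnorm V v = 0")
  case True
  then have "vinner V v u = 0" using v u inner_zero vnorm_eq_zero by simp
  then show ?thesis using True inner_commute[OF v u] by simp
next
  case False
  define n where "n = (vnorm V v)\<^sup>2"
  have n: "n > 0" using False by (simp add: n_def)
  let ?z = "vinner V u v"
  \<comment> \<open>this coefficient minimizes the norm of \<open>u + c v\<close>\<close>
  let ?c = "- ?z / of_real n"
  have "Re (cnj ?c * ?z) = - (cmod ?z)\<^sup>2 / n"
    by (simp only: cmod_power2) (simp add: power2_eq_square diff_divide_distrib add_divide_distrib)
  moreover have "(cmod ?c)\<^sup>2 * n = (cmod ?z)\<^sup>2 / n"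
    using n by (simp add: norm_divide power_divide power2_eq_square)
  moreover have "0 \<le> (vnorm V (vadd V u (vscale V ?c v)))\<^sup>2" by simp
  ultimately have "0 \<le> (vnorm V u)\<^sup>2 - (cmod ?z)\<^sup>2 / n"
    using vnorm_add_scale_sq[OF u v, of ?c] unfolding n_def by linarith
  then have "(cmod ?z)\<^sup>2 \<le> (vnorm V u * vnorm V v)\<^sup>2"
    using n by (simp add: field_simps n_def)
  then show ?thesis
    by (rule power2_le_imp_le) (simp add: u v vnorm_nonneg)
qed

lemma Re_inner_le: "\<lbrakk>u \<in> vecs V; v \<in> vecs V\<rbrakk> \<Longrightarrow> \<bar>Re (vinner V u v)\<bar> \<le> vnorm V u * vnorm V v"
  using Cauchy_Schwarz[of u v] abs_Re_le_cmod[of "vinner V u v"] by linarith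

lemma vnorm_triangle:
  assumes "u \<in> vecs V" "v \<in> vecs V"
  shows "vnorm V (vadd V u v) \<le> vnorm V u + vnorm V v"
proof (rule power2_le_imp_le)
  show "(vnorm V (vadd V u v))\<^sup>2 \<le> (vnorm V u + vnorm V v)\<^sup>2"
    using Re_inner_le[OF assms] by (simp add: vnorm_add_sq[OF assms] power2_sum)
  show "0 \<le> vnorm V u + vnorm V v" using assms by (simp add: vnorm_nonneg)
qed

lemma vnorm_triangle_diff:
  assumes "u \<in> vecs V" "v \<in> vecs V"
  shows "vnorm V (vdiff V u v) \<le> vnorm V u + vnorm V v"
  using vnorm_triangle[of u "vscale V (- 1) v"] assms
  by (simp add: vdiff_def scale_closed vnorm_scale)

lemma diff_eq_zero:
  assumes "u \<in> vecs V" "v \<in> vecs V"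
  shows "vdiff V u v = vzero V \<longleftrightarrow> u = v"
proof
  have vv: "vadd V (vscale V (- 1) v) v = vzero V"
    using scale_add_left[OF assms(2), of "- 1" 1] assms by (simp add: scale_one scale_zero_left)
  { assume "vdiff V u v = vzero V"
    then have "vadd V u (vadd V (vscale V (- 1) v) v) = vadd V (vzero V) v"
      unfolding vdiff_def using assms by (simp add: add_assoc[symmetric] scale_closed)
    then show "u = v"
      using vv assms add_zero add_commute[OF zero_closed] by simp }
  { assume "u = v"
    then show "vdiff V u v = vzero V"
      using vv assms by (simp add: vdiff_def add_commute scale_closed) }
qed

lemma diff_add_diff:
  assumes "u \<in> vecs V" "v \<in> vecs V" "w \<in> vecs V"
  shows "vadd V (vdiff V u v) (vdiff V v w) = vdiff V u w"
proof -
  have vv: "vadd V (vscale V (- 1) v) v = vzero V"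
    using scale_add_left[OF assms(2), of "- 1" 1] assms by (simp add: scale_one scale_zero_left)
  have "vadd V (vdiff V u v) (vdiff V v w)
      = vadd V u (vadd V (vadd V (vscale V (- 1) v) v) (vscale V (- 1) w))"
    unfolding vdiff_def using assms by (simp add: add_assoc add_closed scale_closed)
  also have "\<dots> = vadd V u (vscale V (- 1) w)"
    using vv assms add_zero add_commute[OF zero_closed] by (simp add: scale_closed)
  finally show ?thesis by (simp add: vdiff_def)
qed

lemma vdist_triangle:
  assumes "u \<in> vecs V" "v \<in> vecs V" "w \<in> vecs V"
  shows "vnorm V (vdiff V u w) \<le> vnorm V (vdiff V u v) + vnorm V (vdiff V v w)"
  using vnorm_triangle[of "vdiff V u v" "vdiff V v w"] diff_add_diff[OF assms] assms
  by (simp add: diff_closed)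

lemma vnorm_diff_commute:
  assumes "u \<in> vecs V" "v \<in> vecs V"
  shows "vnorm V (vdiff V u v) = vnorm V (vdiff V v u)"
proof -
  have "Re (vinner V v u) = Re (vinner V u v)"
    using inner_commute[OF assms] by simp
  then have "(vnorm V (vdiff V u v))\<^sup>2 = (vnorm V (vdiff V v u))\<^sup>2"
    by (simp add: vnorm_diff_sq[OF assms] vnorm_diff_sq[OF assms(2,1)])
  then show ?thesis using assms by (simp add: vnorm_nonneg diff_closed)
qed

lemma vnorm_le_add_diff:
  assumes "u \<in> vecs V" "v \<in> vecs V"
  shows "vnorm V v \<le> vnorm V u + vnorm V (vdiff V u v)"
proof -
  have "vdiff V z (vzero V) = z" if "z \<in> vecs V" for z
    using that by (simp add: vdiff_def scale_zero_right add_zero)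
  then show ?thesis
    using vdist_triangle[of v u "vzero V"] assms zero_closed vnorm_diff_commute[of u v] by simp
qed

lemma Metric_space_vdist: "Metric_space (vecs V) (vdist V)"
proof
  show "0 \<le> vdist V x y" for x y
    by (simp add: vdist_def vnorm_nonneg diff_closed)
  show "vdist V x y = vdist V y x" for x y
    using vnorm_diff_commute[of x y] by (simp add: vdist_def)
  show "vdist V x y = 0 \<longleftrightarrow> x = y" if "x \<in> vecs V" "y \<in> vecs V" for x y
    using that by (simp add: vdist_def vnorm_eq_zero diff_closed diff_eq_zero)
  show "vdist V x z \<le> vdist V x y + vdist V y z"
    if "x \<in> vecs V" "y \<in> vecs V" "z \<in> vecs V" for x y z
    using that by (simp add: vdist_def vdist_triangle)
qed

lemma topspace_norm_topology: "topspace (norm_topology V) = vecs V"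
  by (simp add: norm_topology_def Metric_space.topspace_mtopology[OF Metric_space_vdist])

text \<open>
  By the Cauchy-Schwarz inequality, pairing with \<open>v\<close> is Lipschitz continuous.
\<close>

lemma openin_inner_preimage:
  assumes v: "v \<in> vecs V" and G: "open G"
  shows "openin (norm_topology V) {u \<in> vecs V. vinner V u v \<in> G}"
  unfolding norm_topology_def Metric_space.openin_mtopology[OF Metric_space_vdist]
proof safe
  fix u assume u: "u \<in> vecs V" and uG: "vinner V u v \<in> G"
  obtain e where e: "e > 0" "ball (vinner V u v) e \<subseteq> G"
    using G uG openE by blast
  define r where "r = e / (vnorm V v + 1)"
  have pos: "vnorm V v + 1 > 0" using vnorm_nonneg[OF v] by linarith
  have r: "r > 0" using e pos by (simp add: r_def)
  have "vinner V w v \<in> G" if w: "w \<in> vecs V" and d: "vnorm V (vdiff V u w) < r" for w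
  proof -
    have "cmod (vinner V u v - vinner V w v) \<le> vnorm V (vdiff V u w) * vnorm V v"
      using Cauchy_Schwarz[OF diff_closed[OF u w] v] u v w by (simp add: inner_diff)
    also have "\<dots> \<le> r * vnorm V v"
      using d v by (simp add: mult_right_mono vnorm_nonneg)
    also have "\<dots> < r * (vnorm V v + 1)" using r by simp
    also have "\<dots> = e" using pos by (simp add: r_def)
    finally show ?thesis using e by (auto simp: dist_norm subset_iff)
  qed
  then show "\<exists>r>0. Metric_space.mball (vecs V) (vdist V) u r \<subseteq> {u \<in> vecs V. vinner V u v \<in> G}"
    using r by (auto simp: Metric_space.mball_def[OF Metric_space_vdist] vdist_def intro!: exI[of _ r])
qed


text \<open>
  Parseval's identity for \<open>u\<close>. Phrasing the expansion of \<open>u\<close> in terms of \<open>F\<close> through inner products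
  keeps all sums among the complex numbers.
\<close>

definition reproduced_by :: "'v set \<Rightarrow> 'v \<Rightarrow> bool" where
  "reproduced_by F u \<longleftrightarrow> (\<forall>v\<in>vecs V. vinner V u v = (\<Sum>e\<in>F. vinner V u e * vinner V e v))"

text \<open>
  The normalized difference of \<open>b\<close> and its projection \<open>p\<close> to the span of \<open>F\<close> is orthogonal to all
  vectors that \<open>F\<close> reproduces, so it can be adjoined to \<open>F\<close> without disturbing them. The existence of
  projections, described by their inner products, is carried along as an invariant.
\<close>

lemma Gram_Schmidt_step:
  assumes F: "finite F" "F \<subseteq> vecs V" "\<forall>e\<in>F. reproduced_by F e"
    and proj: "\<forall>u\<in>vecs V. \<exists>p\<in>vecs V. \<forall>v\<in>vecs V. vinner V p v = (\<Sum>e\<in>F. vinner V u e * vinner V e v)"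
    and b: "b \<in> vecs V"
  shows "\<exists>F'. finite F' \<and> F' \<subseteq> vecs V \<and> (\<forall>e\<in>F'. reproduced_by F' e) \<and>
    (\<forall>u\<in>vecs V. \<exists>p\<in>vecs V. \<forall>v\<in>vecs V. vinner V p v = (\<Sum>e\<in>F'. vinner V u e * vinner V e v)) \<and>
    reproduced_by F' b \<and> (\<forall>u\<in>vecs V. reproduced_by F u \<longrightarrow> reproduced_by F' u)"
proof -
  obtain p where p: "p \<in> vecs V"
    and p_inner: "\<And>v. v \<in> vecs V \<Longrightarrow> vinner V p v = (\<Sum>e\<in>F. vinner V b e * vinner V e v)"
    using proj b by metis
  define d where "d = vdiff V b p"
  have d: "d \<in> vecs V" using b p by (simp add: d_def diff_closed)
  have d_inner: "vinner V d v = vinner V b v - vinner V p v" if "v \<in> vecs V" for v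
    using b p that by (simp add: d_def inner_diff)
  show ?thesis
  proof (cases "vnorm V d = 0")
    case True
    then have "b = p" using d b p by (simp add: vnorm_eq_zero diff_eq_zero d_def)
    then have "reproduced_by F b" using p_inner by (simp add: reproduced_by_def)
    then show ?thesis using F proj by blast
  next
    case False
    define e where "e = vscale V (of_real (1 / vnorm V d)) d"
    have e: "e \<in> vecs V" using d by (simp add: e_def scale_closed)
    have e_inner: "vinner V e v = of_real (1 / vnorm V d) * vinner V d v" if "v \<in> vecs V" for v
      using d that by (simp only: e_def inner_scale)
    have "vnorm V e = 1"
      unfolding e_def vnorm_scale[OF d] using False vnorm_nonneg[OF d] by (simp add: norm_divide)
    then have ee: "vinner V e e = 1" using inner_self[OF e] by simp
    have d_eq: "vinner V d v = of_real (vnorm V d) * vinner V e v" if "v \<in> vecs V" for v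
      using e_inner[OF that] False by simp
    \<comment> \<open>for such \<open>u\<close> both \<open>b\<close> and \<open>p\<close> have the same inner product with \<open>u\<close>, and \<open>e\<close> is a multiple of \<open>b - p\<close>\<close>
    have orth: "vinner V u e = 0" if u: "u \<in> vecs V" and "reproduced_by F u" for u
    proof -
      have "vinner V p u = (\<Sum>x\<in>F. cnj (vinner V u x * vinner V x b))"
        unfolding p_inner[OF u]
      proof (rule sum.cong[OF refl])
        fix x assume "x \<in> F"
        then have x: "x \<in> vecs V" using F(2) by blast
        show "vinner V b x * vinner V x u = cnj (vinner V u x * vinner V x b)"
          using inner_commute[OF x b] inner_commute[OF u x] by simp
      qed
      also have "\<dots> = cnj (vinner V u b)"
        using that b by (simp add: reproduced_by_def)
      finally have "vinner V e u = 0"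
        using u b by (simp add: e_inner d_inner inner_commute[OF u b])
      then show ?thesis using inner_commute[OF e u] by simp
    qed
    have orthF: "vinner V x e = 0" "vinner V e x = 0" if "x \<in> F" for x
      using orth[of x] F that inner_commute[of x e] e by auto
    then have "e \<notin> F" using ee by auto
    then have sum': "(\<Sum>x\<in>insert e F. vinner V u x * vinner V x v)
        = vinner V u e * vinner V e v + (\<Sum>x\<in>F. vinner V u x * vinner V x v)" for u v
      using F(1) by simp
    have old: "reproduced_by (insert e F) u" if "u \<in> vecs V" "reproduced_by F u" for u
      using that orth[OF that] unfolding reproduced_by_def sum' by simp
    have new: "reproduced_by (insert e F) e"
      unfolding reproduced_by_def sum' using orthF ee by simp
    have "reproduced_by (insert e F) b"
      unfolding reproduced_by_def sum'
    proof
      fix v assume v: "v \<in> vecs V"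
      have "vinner V p e = 0" using p_inner[OF e] orthF by simp
      then have "vinner V b e = of_real (vnorm V d)"
        using d_inner[OF e] d_eq[OF e] ee by simp
      then show "vinner V b v = vinner V b e * vinner V e v + (\<Sum>x\<in>F. vinner V b x * vinner V x v)"
        using d_inner[OF v] d_eq[OF v] p_inner[OF v] by (simp add: algebra_simps)
    qed
    moreover have "\<exists>p'\<in>vecs V. \<forall>v\<in>vecs V.
        vinner V p' v = (\<Sum>x\<in>insert e F. vinner V u x * vinner V x v)" if u: "u \<in> vecs V" for u
    proof -
      obtain r where "r \<in> vecs V"
        "\<forall>v\<in>vecs V. vinner V r v = (\<Sum>x\<in>F. vinner V u x * vinner V x v)"
        using proj u by metis
      then show ?thesis
        unfolding sum' using e
        by (intro bexI[of _ "vadd V (vscale V (vinner V u e) e) r"])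
          (auto simp: inner_add inner_scale scale_closed add_closed)
    qed
    ultimately show ?thesis
      using F e old new by (intro exI[of _ "insert e F"]) blast
  qed
qed

text \<open>
  The vectors reproduced by \<open>F\<close> form a linear subspace. Once the Gram-Schmidt process has run through
  a finite generating set, this subspace is the whole space.
\<close>

lemma finite_Parseval_frame:
  assumes "finite_dimensional V"
  obtains F where "finite F" "F \<subseteq> vecs V"
    "\<And>u v. \<lbrakk>u \<in> vecs V; v \<in> vecs V\<rbrakk> \<Longrightarrow> vinner V u v = (\<Sum>e\<in>F. vinner V u e * vinner V e v)"
proof -
  obtain B where B: "finite B" "B \<subseteq> vecs V"
    "\<And>S. \<lbrakk>linear_subspace V S; B \<subseteq> S\<rbrakk> \<Longrightarrow> S = vecs V"
    using assms unfolding finite_dimensional_def by blast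
  have "\<exists>F. finite F \<and> F \<subseteq> vecs V \<and> (\<forall>e\<in>F. reproduced_by F e) \<and>
    (\<forall>u\<in>vecs V. \<exists>p\<in>vecs V. \<forall>v\<in>vecs V. vinner V p v = (\<Sum>e\<in>F. vinner V u e * vinner V e v)) \<and>
    (\<forall>b\<in>B. reproduced_by F b)"
    using B(1,2)
  proof (induction B rule: finite_induct)
    case empty
    show ?case
      using zero_closed inner_zero by (intro exI[of _ "{}"]) auto
  next
    case (insert b B)
    then obtain F where F: "finite F" "F \<subseteq> vecs V" "\<forall>e\<in>F. reproduced_by F e"
      "\<forall>u\<in>vecs V. \<exists>p\<in>vecs V. \<forall>v\<in>vecs V. vinner V p v = (\<Sum>e\<in>F. vinner V u e * vinner V e v)"
      and FB: "\<forall>b\<in>B. reproduced_by F b"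
      by auto
    have b: "b \<in> vecs V" and "B \<subseteq> vecs V" using insert.prems by auto
    obtain F' where "finite F'" "F' \<subseteq> vecs V" "\<forall>e\<in>F'. reproduced_by F' e"
      "\<forall>u\<in>vecs V. \<exists>p\<in>vecs V. \<forall>v\<in>vecs V. vinner V p v = (\<Sum>e\<in>F'. vinner V u e * vinner V e v)"
      "reproduced_by F' b" "\<forall>u\<in>vecs V. reproduced_by F u \<longrightarrow> reproduced_by F' u"
      using Gram_Schmidt_step[OF F b] by blast
    then show ?case
      using FB \<open>B \<subseteq> vecs V\<close> by (intro exI[of _ F']) blast
  qed
  then obtain F where F: "finite F" "F \<subseteq> vecs V" "\<forall>b\<in>B. reproduced_by F b"
    by blast
  have "linear_subspace V {u \<in> vecs V. reproduced_by F u}"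
    unfolding linear_subspace_def
  proof (intro conjI ballI allI)
    have Fv: "x \<in> vecs V" if "x \<in> F" for x using that F(2) by blast
    show "vzero V \<in> {u \<in> vecs V. reproduced_by F u}"
      by (simp add: reproduced_by_def zero_closed inner_zero Fv)
    fix u assume "u \<in> {u \<in> vecs V. reproduced_by F u}"
    then have u: "u \<in> vecs V"
      and uF: "\<And>w. w \<in> vecs V \<Longrightarrow> (\<Sum>e\<in>F. vinner V u e * vinner V e w) = vinner V u w"
      by (simp_all add: reproduced_by_def)
    have "(\<Sum>e\<in>F. vinner V (vscale V c u) e * vinner V e w) = c * vinner V u w"
      if "w \<in> vecs V" for c w
      unfolding uF[OF that, symmetric]
      using u by (simp add: inner_scale Fv sum_distrib_left mult.assoc)
    then show "vscale V c u \<in> {u \<in> vecs V. reproduced_by F u}" for c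
      using u by (simp add: reproduced_by_def scale_closed inner_scale)
    fix v assume "v \<in> {u \<in> vecs V. reproduced_by F u}"
    then have v: "v \<in> vecs V"
      and vF: "\<And>w. w \<in> vecs V \<Longrightarrow> (\<Sum>e\<in>F. vinner V v e * vinner V e w) = vinner V v w"
      by (simp_all add: reproduced_by_def)
    have "(\<Sum>e\<in>F. vinner V (vadd V u v) e * vinner V e w) = vinner V u w + vinner V v w"
      if "w \<in> vecs V" for w
      unfolding uF[OF that, symmetric] vF[OF that, symmetric]
      using u v by (simp add: inner_add Fv distrib_right sum.distrib)
    then show "vadd V u v \<in> {u \<in> vecs V. reproduced_by F u}"
      using u v by (simp add: reproduced_by_def add_closed inner_add)
  qed auto
  then have "{u \<in> vecs V. reproduced_by F u} = vecs V"
    using B F(3) by blast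
  then show ?thesis
    using that[OF F(1,2)] unfolding reproduced_by_def by blast
qed

end

text \<open>
  The norm of \<open>u + v\<close> determines the real part of the inner product; the imaginary part is the real
  part of the inner product of \<open>- \<i> u\<close> and \<open>v\<close>.
\<close>

lemma isometric_isomorphism_inner:
  assumes "complex_inner_space V" "complex_inner_space W"
    and f: "isometric_isomorphism V W f" and u: "u \<in> vecs V" and v: "v \<in> vecs V"
  shows "vinner W (f u) (f v) = vinner V u v"
proof -
  interpret V: complex_inner_space V by fact
  interpret W: complex_inner_space W by fact
  have fW: "f w \<in> vecs W" if "w \<in> vecs V" for w
    using f that unfolding isometric_isomorphism_def bij_betw_def by blast
  have scale: "f (vscale V c w) = vscale W c (f w)"
    and norm: "vnorm W (f w) = vnorm V w" if "w \<in> vecs V" for c w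
    using f that by (auto simp: isometric_isomorphism_def)
  have Re: "Re (vinner W (f w) (f v)) = Re (vinner V w v)" if w: "w \<in> vecs V" for w
  proof -
    have "f (vadd V w v) = vadd W (f w) (f v)"
      using f v w by (auto simp: isometric_isomorphism_def)
    then have "(vnorm W (vadd W (f w) (f v)))\<^sup>2 = (vnorm V (vadd V w v))\<^sup>2"
      using norm[OF V.add_closed[OF w v]] by simp
    then show ?thesis
      by (simp add: V.vnorm_add_sq[OF w v] W.vnorm_add_sq[OF fW[OF w] fW[OF v]] norm w v)
  qed
  have "Im (vinner W (f u) (f v)) = Im (vinner V u v)"
    using Re[OF V.scale_closed[OF u, of "- \<i>"]] u v
    by (simp add: scale V.inner_scale W.inner_scale fW)
  then show ?thesis using Re[OF u] by (simp add: complex_eq_iff)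
qed


section \<open>The inner product space of a form domain\<close>

text \<open>
  The form domain with the inner product that induces the form norm.
\<close>

definition form_space :: "'v inner_structure \<Rightarrow> 'v qform \<Rightarrow> real \<Rightarrow> 'v inner_structure" where
  "form_space V q m =
     V\<lparr>vecs := fdom q, vinner := \<lambda>u v. polar V q u v + of_real m * vinner V u v\<rparr>"

text \<open>
  A sesquilinear form with a real diagonal is Hermitian: reality at \<open>u + v\<close> relates the imaginary parts
  of the values at \<open>(u, v)\<close> and \<open>(v, u)\<close>, reality at \<open>u + \<i> v\<close> relates the real parts.
\<close>

lemma (in quadratic_form) polar_commute:
  assumes u: "u \<in> fdom q" and v: "v \<in> fdom q"
  shows "polar V q v u = cnj (polar V q u v)"
proof -
  have add: "vadd V u w \<in> fdom q" if "w \<in> fdom q" for w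
    using dom_subspace u that by (auto simp: linear_subspace_def)
  have sc: "vscale V \<i> v \<in> fdom q"
    using dom_subspace v by (auto simp: linear_subspace_def)
  have real: "Im (polar V q u w) + Im (polar V q w u) = 0" if w: "w \<in> fdom q" for w
  proof -
    have "polar V q (vadd V u w) (vadd V u w)
      = polar V q u u + polar V q u w + (polar V q w u + polar V q w w)"
      using u w add[OF w] by (simp add: polar_add_left polar_add_right)
    then show ?thesis
      using polar_diagonal[OF add[OF w]] polar_diagonal[OF u] polar_diagonal[OF w]
      by (simp add: complex_eq_iff)
  qed
  show ?thesis
    using real[OF v] real[OF sc] u v sc
    by (simp add: complex_eq_iff polar_scale_left polar_scale_right)
qed

text \<open>
  The laws of an inner product space are assumed on the form domain, since this is the subspace on
  which they are available for classes of sections. The parameter \<open>l\<close> names a lower bound below \<open>m\<close>.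
\<close>

locale closed_form_space =
  fixes V :: "'v inner_structure" and q :: "'v qform" and m l :: real
  assumes inner_space_dom: "complex_inner_space (V\<lparr>vecs := fdom q\<rparr>)"
    and closed: "closed_form V q m"
    and lower: "lower_bound V q l"
    and l_less: "l < m"
begin

sublocale quadratic_form V q
  using closed by (simp add: closed_form_def)

sublocale dom: complex_inner_space "V\<lparr>vecs := fdom q\<rparr>"
  rewrites "vecs (V\<lparr>vecs := fdom q\<rparr>) = fdom q"
    and "vzero (V\<lparr>vecs := fdom q\<rparr>) = vzero V"
    and "vadd (V\<lparr>vecs := fdom q\<rparr>) = vadd V"
    and "vscale (V\<lparr>vecs := fdom q\<rparr>) = vscale V"
    and "vinner (V\<lparr>vecs := fdom q\<rparr>) = vinner V"
    and "vnorm (V\<lparr>vecs := fdom q\<rparr>) = vnorm V"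
    and "vdiff (V\<lparr>vecs := fdom q\<rparr>) = vdiff V"
  by (rule inner_space_dom) (auto simp: vnorm_def vdiff_def fun_eq_iff)

lemma form_bound: "u \<in> fdom q \<Longrightarrow> (m - l) * (vnorm V u)\<^sup>2 \<le> fval q u + m * (vnorm V u)\<^sup>2"
  using lower by (auto simp: lower_bound_def algebra_simps)

lemma inner_space_form: "complex_inner_space (form_space V q m)"
proof -
  have self: "polar V q u u + of_real m * vinner V u u = of_real (fval q u + m * (vnorm V u)\<^sup>2)"
    if "u \<in> fdom q" for u
    using that by (simp add: polar_diagonal dom.inner_self)
  have nonneg: "0 \<le> fval q u + m * (vnorm V u)\<^sup>2" if "u \<in> fdom q" for u
    using form_bound[OF that] l_less by (smt (verit) mult_nonneg_nonneg zero_le_power2)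
  have "u = vzero V" if u: "u \<in> fdom q" and "fval q u + m * (vnorm V u)\<^sup>2 = 0" for u
  proof -
    have "(m - l) * (vnorm V u)\<^sup>2 \<le> 0" using form_bound[OF u] that by simp
    then have "vnorm V u = 0"
      using l_less by (simp add: mult_le_0_iff)
    then show ?thesis using dom.vnorm_eq_zero[OF u] by simp
  qed
  note definite = this
  show ?thesis
    unfolding form_space_def
  proof (unfold_locales, goal_cases)
    case (5 u v)
    then show ?case using dom.add_commute[of u v] by simp
  next
    case (14 u v)
    then show ?case using dom.inner_commute[of u v] polar_commute[of u v] by simp
  next
    case (16 u)
    then show ?case using self[of u] definite[of u] by (simp flip: of_real_add of_real_mult of_real_power)
  qed (simp_all add: dom.zero_closed dom.add_closed dom.scale_closed dom.add_assoc
      dom.add_zero dom.add_inverse dom.scale_one dom.scale_scale dom.scale_add_right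
      dom.scale_add_left dom.inner_add dom.inner_scale polar_add_left polar_scale_left
      distrib_left self nonneg del: of_real_add of_real_mult of_real_power)
qed

sublocale form: complex_inner_space "form_space V q m"
  rewrites "vecs (form_space V q m) = fdom q"
    and "vzero (form_space V q m) = vzero V"
    and "vadd (form_space V q m) = vadd V"
    and "vscale (form_space V q m) = vscale V"
    and "vdiff (form_space V q m) = vdiff V"
  by (rule inner_space_form) (auto simp: form_space_def vdiff_def fun_eq_iff)

lemma form_norm_eq: "u \<in> fdom q \<Longrightarrow> form_norm V q m u = vnorm (form_space V q m) u"
  unfolding form_norm_def vnorm_def[of "form_space V q m"]
  by (simp add: form_space_def polar_diagonal dom.inner_self)

lemma vnorm_le_form_norm:
  assumes "u \<in> fdom q"
  shows "vnorm V u \<le> form_norm V q m u / sqrt (m - l)"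
proof -
  have "sqrt ((m - l) * (vnorm V u)\<^sup>2) \<le> form_norm V q m u"
    unfolding form_norm_def using form_bound[OF assms] by (rule real_sqrt_le_mono)
  then have "sqrt (m - l) * vnorm V u \<le> form_norm V q m u"
    using dom.vnorm_nonneg[OF assms] by (simp add: real_sqrt_mult)
  then show ?thesis
    using l_less by (simp add: pos_le_divide_eq mult.commute)
qed

text \<open>
  A bounded sequence in the Hilbert space of the form that converges to \<open>u\<close> in the ambient norm
  converges weakly, so suitable convex combinations converge in form norm. The argument makes these
  combinations explicit: \<open>C n\<close> consists of the elements of \<open>S\<close> at distance less than \<open>1 / (n + 1)\<close> from \<open>u\<close>,
  a convex set, and \<open>d n\<close> is the infimum of the squared form norm on it. The sequence \<open>d\<close> increases and
  is bounded, hence converges, and then the parallelogram law forces elements \<open>c n\<close> of \<open>C n\<close> with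
  squared norm close to \<open>d n\<close> to be a Cauchy sequence. Its limit in form norm is also its limit in the
  ambient norm, which is \<open>u\<close>.
\<close>

theorem approximation_from_bounded:
  assumes S: "linear_subspace V S" "S \<subseteq> fdom q" and u: "u \<in> fdom q"
    and bounded: "\<And>\<epsilon>. \<epsilon> > 0 \<Longrightarrow> \<exists>v\<in>S. vnorm V (vdiff V u v) < \<epsilon> \<and> form_norm V q m v \<le> B"
    and \<epsilon>: "\<epsilon> > 0"
  shows "\<exists>v\<in>S. form_norm V q m (vdiff V u v) < \<epsilon>"
proof -
  let ?N = "vnorm (form_space V q m)"
  define C where "C n = {v \<in> S. vnorm V (vdiff V u v) < inverse (real (Suc n))}" for n
  define d where "d n = Inf ((\<lambda>v. (?N v)\<^sup>2) ` C n)" for n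
  have CD: "v \<in> fdom q" if "v \<in> C n" for v n
    using that S by (auto simp: C_def)
  have bdd: "bdd_below ((\<lambda>v. (?N v)\<^sup>2) ` C n)" for n
    by (intro bdd_belowI[of _ 0]) auto
  have d_le: "d n \<le> (?N v)\<^sup>2" if "v \<in> C n" for n v
    unfolding d_def using bdd that by (auto intro: cINF_lower)
  have C_mono: "C j \<subseteq> C i" if "i \<le> j" for i j
  proof -
    have "inverse (real (Suc j)) \<le> inverse (real (Suc i))" using that by (simp add: field_simps)
    from less_le_trans[OF _ this] show ?thesis unfolding C_def by blast
  qed
  have C_bounded: "\<exists>v\<in>C n. ?N v \<le> B" for n
    using bounded[of "inverse (real (Suc n))"] S by (auto simp: C_def form_norm_eq subset_iff)
  then have C_ne: "C n \<noteq> {}" for n by blast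
  have d_mono: "incseq d"
    unfolding d_def incseq_def using C_mono C_ne bdd by (auto intro!: cINF_superset_mono)
  have "d n \<le> B\<^sup>2" for n
  proof -
    obtain v where v: "v \<in> C n" "?N v \<le> B" using C_bounded by blast
    then show ?thesis
      using d_le[OF v(1)] power_mono[OF v(2), of 2] form.vnorm_nonneg[OF CD[OF v(1)]] by linarith
  qed
  then obtain L where lim: "d \<longlonglongrightarrow> L" and dL: "\<And>n. d n \<le> L"
    using incseq_convergent[OF d_mono] by blast
  have "\<exists>v\<in>C n. (?N v)\<^sup>2 < d n + inverse (real (Suc n))" for n
    using cINF_less_iff[OF C_ne[of n] bdd, of "d n + inverse (real (Suc n))"]
    by (simp add: d_def)
  then obtain c where c: "\<And>n. c n \<in> C n" and cN: "\<And>n. (?N (c n))\<^sup>2 < d n + inverse (real (Suc n))"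
    by metis
  have cD: "c n \<in> fdom q" for n using CD c by blast
  \<comment> \<open>the midpoint of two almost minimizers is a competitor, so the parallelogram law applies\<close>
  have close: "(?N (vdiff V (c i) (c j)))\<^sup>2 \<le> 4 * (L - d n) + 4 * inverse (real (Suc n))"
    if "n \<le> i" "n \<le> j" for i j n
  proof -
    let ?w = "vscale V (1/2) (vadd V (c i) (c j))"
    have ci: "c i \<in> C n" and cj: "c j \<in> C n" using C_mono c that by blast+
    have wD: "?w \<in> fdom q" using cD by (simp add: dom.scale_closed dom.add_closed)
    have "vnorm V (vdiff V u ?w) < inverse (real (Suc n))"
    proof -
      have "vnorm V (vdiff V u ?w)
        \<le> (vnorm V (vdiff V u (c i)) + vnorm V (vdiff V u (c j))) / 2"
        using dom.vnorm_triangle[of "vdiff V u (c i)" "vdiff V u (c j)"] u cD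
        by (simp add: dom.midpoint_diff dom.vnorm_scale dom.add_closed dom.diff_closed)
      then show ?thesis using ci cj by (auto simp: C_def)
    qed
    moreover have "?w \<in> S"
      using S ci cj by (auto simp: linear_subspace_def C_def)
    ultimately have "d n \<le> (?N ?w)\<^sup>2" by (intro d_le) (simp add: C_def)
    moreover have "inverse (real (Suc i)) \<le> inverse (real (Suc n))"
      "inverse (real (Suc j)) \<le> inverse (real (Suc n))" using that by (simp_all add: field_simps)
    ultimately show ?thesis
      using form.parallelogram[OF cD cD, of i j] cN[of i] cN[of j] dL[of i] dL[of j] by argo
  qed
  have lim4: "(\<lambda>n. 4 * (L - d n) + 4 * inverse (real (Suc n))) \<longlonglongrightarrow> 4 * (L - L) + 4 * 0"
    by (intro tendsto_intros lim LIMSEQ_inverse_real_of_nat)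
  have "\<exists>N. \<forall>i\<ge>N. \<forall>j\<ge>N. form_norm V q m (vdiff V (c i) (c j)) < \<delta>" if \<delta>: "\<delta> > 0" for \<delta>
  proof -
    have "\<forall>\<^sub>F n in sequentially. 4 * (L - d n) + 4 * inverse (real (Suc n)) < \<delta>\<^sup>2"
      using order_tendstoD(2)[OF lim4, of "\<delta>\<^sup>2"] \<delta> by simp
    then obtain N where N: "4 * (L - d N) + 4 * inverse (real (Suc N)) < \<delta>\<^sup>2"
      by (auto simp: eventually_sequentially)
    have "?N (vdiff V (c i) (c j)) < \<delta>" if "i \<ge> N" "j \<ge> N" for i j
      using close[OF that] N \<delta> by (intro power2_less_imp_less[of _ \<delta>]) auto
    then show ?thesis
      using cD by (auto simp: form_norm_eq dom.diff_closed)
  qed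
  then obtain w where w: "w \<in> fdom q" and cw: "(\<lambda>n. form_norm V q m (vdiff V (c n) w)) \<longlonglongrightarrow> 0"
    using closed cD unfolding closed_form_def by blast
  have "vnorm V (vdiff V u w) \<le> 0"
  proof (rule LIMSEQ_le_const)
    show "(\<lambda>n. inverse (real (Suc n)) + form_norm V q m (vdiff V (c n) w) / sqrt (m - l)) \<longlonglongrightarrow> 0"
      using tendsto_add[OF LIMSEQ_inverse_real_of_nat tendsto_divide_zero[OF cw, of "sqrt (m - l)"]]
      by simp
    have "vnorm V (vdiff V u w)
      \<le> inverse (real (Suc n)) + form_norm V q m (vdiff V (c n) w) / sqrt (m - l)" for n
      using dom.vdist_triangle[OF u cD w, of n] c[of n] w
        vnorm_le_form_norm[OF dom.diff_closed[OF cD w], of n] by (auto simp: C_def)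
    then show "\<exists>N. \<forall>n\<ge>N. vnorm V (vdiff V u w)
      \<le> inverse (real (Suc n)) + form_norm V q m (vdiff V (c n) w) / sqrt (m - l)" by blast
  qed
  then have "vnorm V (vdiff V u w) = 0"
    using dom.vnorm_nonneg[OF dom.diff_closed[OF u w]] by simp
  then have "u = w"
    using u w by (simp add: dom.vnorm_eq_zero dom.diff_closed dom.diff_eq_zero)
  then obtain n where "form_norm V q m (vdiff V (c n) u) < \<epsilon>"
    using order_tendstoD(2)[OF cw \<epsilon>] by (auto simp: eventually_sequentially)
  moreover have "form_norm V q m (vdiff V (c n) u) = form_norm V q m (vdiff V u (c n))"
    using u cD[of n] form.vnorm_diff_commute[of u "c n"] by (simp add: form_norm_eq dom.diff_closed)
  ultimately show ?thesis
    using c[of n] by (auto simp: C_def)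
qed

end


section \<open>Almost everywhere classes of square integrable fields\<close>

text \<open>
  The common frame for square integrable functions and square integrable sections. Measurability enters
  through the pointwise inner products, because these are what the inner product of classes integrates.
\<close>

locale square_integrable_field =
  fixes M :: "'x measure" and F :: "'x \<Rightarrow> 'e inner_structure" and S :: "('x \<Rightarrow> 'e) set"
  assumes inner_space_fibre: "x \<in> space M \<Longrightarrow> complex_inner_space (F x)"
    and value_in_fibre: "\<lbrakk>f \<in> S; x \<in> space M\<rbrakk> \<Longrightarrow> f x \<in> vecs (F x)"
    and inner_measurable: "\<lbrakk>f \<in> S; g \<in> S\<rbrakk> \<Longrightarrow> (\<lambda>x. vinner (F x) (f x) (g x)) \<in> borel_measurable M"
    and norm_sq_integrable: "f \<in> S \<Longrightarrow> integrable M (\<lambda>x. (vnorm (F x) (f x))\<^sup>2)"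
begin

abbreviation W :: "('x \<Rightarrow> 'e) set inner_structure" where
  "W \<equiv> class_space M F S"

lemma rep_in: "A \<in> vecs W \<Longrightarrow> rep A \<in> A"
  unfolding rep_def some_in_eq by (auto simp: class_space_def ae_class_def)

lemma rep_in_S: "A \<in> vecs W \<Longrightarrow> rep A \<in> S"
  using rep_in[of A] by (auto simp: class_space_def ae_class_def)

lemma class_of_rep:
  assumes "A \<in> vecs W"
  shows "A = ae_class M S (rep A)"
proof -
  obtain f where A: "A = ae_class M S f" using assms by (auto simp: class_space_def)
  then have "AE x in M. rep A x = f x"
    using rep_in[OF assms] by (simp add: ae_class_def)
  then have "(AE x in M. g x = f x) \<longleftrightarrow> (AE x in M. g x = rep A x)" for g
    by (intro eventually_cong[where P="\<lambda>x. rep A x = f x"]) auto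
  then show ?thesis by (subst A) (simp add: ae_class_def)
qed

lemma rep_class: "ae_class M S h \<in> vecs W \<Longrightarrow> AE x in M. rep (ae_class M S h) x = h x"
  using rep_in[of "ae_class M S h"] by (simp add: ae_class_def)

lemma class_eqI:
  assumes "A \<in> vecs W" "B \<in> vecs W" "AE x in M. rep A x = rep B x"
  shows "A = B"
proof -
  have "(AE x in M. g x = rep A x) \<longleftrightarrow> (AE x in M. g x = rep B x)" for g
    using assms(3) by (intro eventually_cong[where P="\<lambda>x. rep A x = rep B x"]) auto
  then show ?thesis
    by (subst class_of_rep[OF assms(1)], subst class_of_rep[OF assms(2)]) (simp add: ae_class_def)
qed

lemma mem_classI:
  assumes "A \<in> vecs W" "f \<in> S" "AE x in M. f x = rep A x"
  shows "f \<in> A"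
  using assms(2,3) by (subst class_of_rep[OF assms(1)]) (simp add: ae_class_def)

lemma mem_classD:
  assumes "A \<in> vecs W" "f \<in> A"
  shows "f \<in> S" "AE x in M. f x = rep A x"
proof -
  have "f \<in> ae_class M S (rep A)"
    using assms(2) by (subst class_of_rep[OF assms(1), symmetric])
  then show "f \<in> S" "AE x in M. f x = rep A x" by (simp_all add: ae_class_def)
qed

text \<open>
  The class of a field is empty unless an element of \<open>S\<close> agrees with the field almost everywhere.
  Membership of a sum or a multiple in the space of classes excludes this, so that its chosen
  representative is meaningful.
\<close>

lemma rep_zero: "vzero W \<in> vecs W \<Longrightarrow> AE x in M. rep (vzero W) x = vzero (F x)"
  using rep_class[of "\<lambda>x. vzero (F x)"] by (simp add: class_space_def)

lemma rep_add:
  "vadd W A B \<in> vecs W \<Longrightarrow> AE x in M. rep (vadd W A B) x = vadd (F x) (rep A x) (rep B x)"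
  using rep_class[of "\<lambda>x. vadd (F x) (rep A x) (rep B x)"] by (simp add: class_space_def)

lemma rep_scale:
  "vscale W c A \<in> vecs W \<Longrightarrow> AE x in M. rep (vscale W c A) x = vscale (F x) c (rep A x)"
  using rep_class[of "\<lambda>x. vscale (F x) c (rep A x)"] by (simp add: class_space_def)

lemma rep_diff:
  assumes "vdiff W A B \<in> vecs W" "vscale W (- 1) B \<in> vecs W"
  shows "AE x in M. rep (vdiff W A B) x = vdiff (F x) (rep A x) (rep B x)"
  using rep_add[OF assms(1)[unfolded vdiff_def]] rep_scale[OF assms(2)]
  by eventually_elim (simp add: vdiff_def)

lemma inner_class: "vinner W A B = (\<integral>x. vinner (F x) (rep A x) (rep B x) \<partial>M)"
  by (simp add: class_space_def)

lemma AE_fibre: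
  assumes "A \<in> vecs W"
  shows "AE x in M. complex_inner_space (F x) \<and> rep A x \<in> vecs (F x)"
  using inner_space_fibre value_in_fibre[OF rep_in_S[OF assms]] by (intro AE_I2) auto

lemma norm_measurable:
  assumes "f \<in> S"
  shows "(\<lambda>x. vnorm (F x) (f x)) \<in> borel_measurable M"
  unfolding vnorm_def using inner_measurable[OF assms assms] by measurable

lemma inner_integrable:
  assumes A: "A \<in> vecs W" and B: "B \<in> vecs W"
  shows "integrable M (\<lambda>x. vinner (F x) (rep A x) (rep B x))"
proof (rule Bochner_Integration.integrable_bound)
  show "integrable M (\<lambda>x. (vnorm (F x) (rep A x))\<^sup>2 + (vnorm (F x) (rep B x))\<^sup>2)"
    using A B by (intro Bochner_Integration.integrable_add norm_sq_integrable rep_in_S)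
  show "(\<lambda>x. vinner (F x) (rep A x) (rep B x)) \<in> borel_measurable M"
    using A B by (intro inner_measurable rep_in_S)
  show "AE x in M. norm (vinner (F x) (rep A x) (rep B x))
      \<le> norm ((vnorm (F x) (rep A x))\<^sup>2 + (vnorm (F x) (rep B x))\<^sup>2)"
    using AE_fibre[OF A] AE_fibre[OF B]
  proof eventually_elim
    case (elim x)
    then interpret complex_inner_space "F x" by blast
    have "cmod (vinner (F x) (rep A x) (rep B x)) \<le> vnorm (F x) (rep A x) * vnorm (F x) (rep B x)"
      using elim by (intro Cauchy_Schwarz) auto
    also have "\<dots> \<le> (vnorm (F x) (rep A x))\<^sup>2 + (vnorm (F x) (rep B x))\<^sup>2"
      using sum_squares_bound[of "vnorm (F x) (rep A x)" "vnorm (F x) (rep B x)"]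
        zero_le_power2[of "vnorm (F x) (rep A x)"] zero_le_power2[of "vnorm (F x) (rep B x)"]
      by linarith
    finally show ?case by simp
  qed
qed

lemma inner_cong:
  assumes "A \<in> vecs W" "B \<in> vecs W" and g: "g \<in> borel_measurable M"
    and "AE x in M. vinner (F x) (rep A x) (rep B x) = g x"
  shows "vinner W A B = (\<integral>x. g x \<partial>M)"
  unfolding inner_class using assms by (intro integral_cong_AE inner_measurable rep_in_S)

lemma inner_self_class:
  assumes A: "A \<in> vecs W"
  shows "vinner W A A = of_real (\<integral>x. (vnorm (F x) (rep A x))\<^sup>2 \<partial>M)"
proof -
  have "vinner W A A = (\<integral>x. complex_of_real ((vnorm (F x) (rep A x))\<^sup>2) \<partial>M)"
    using norm_measurable[OF rep_in_S[OF A]]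
  proof (intro inner_cong A)
    show "AE x in M. vinner (F x) (rep A x) (rep A x) = complex_of_real ((vnorm (F x) (rep A x))\<^sup>2)"
      using AE_fibre[OF A] by eventually_elim (metis complex_inner_space.inner_self)
  qed simp
  then show ?thesis by (simp only: integral_complex_of_real)
qed

lemma vnorm_class: "A \<in> vecs W \<Longrightarrow> vnorm W A = sqrt (\<integral>x. (vnorm (F x) (rep A x))\<^sup>2 \<partial>M)"
  unfolding vnorm_def[of W] by (simp add: inner_self_class)

text \<open>
  A subspace \<open>D\<close> is closed under the operations, so the classes of all sums and multiples of its elements
  have representatives. The algebraic laws then hold almost everywhere in the fibres.
\<close>

theorem complex_inner_space_class:
  assumes D: "linear_subspace W D"
  shows "complex_inner_space (W\<lparr>vecs := D\<rparr>)"
proof -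
  have DW: "A \<in> vecs W" if "A \<in> D" for A using D that by (auto simp: linear_subspace_def)
  have zero: "vzero W \<in> D" and add: "\<lbrakk>A \<in> D; B \<in> D\<rbrakk> \<Longrightarrow> vadd W A B \<in> D"
    and scale: "A \<in> D \<Longrightarrow> vscale W c A \<in> D" for A B c
    using D by (auto simp: linear_subspace_def)
  note rep_zero' = rep_zero[OF DW[OF zero]]
    and rep_add' = rep_add[OF DW[OF add]] and rep_scale' = rep_scale[OF DW[OF scale]]
  show ?thesis
  proof (unfold_locales, simp_all add: zero add scale, goal_cases)
    case (1 A B C)
    show ?case
    proof (rule class_eqI)
      show "AE x in M. rep (vadd W (vadd W A B) C) x = rep (vadd W A (vadd W B C)) x"
        using rep_add'[OF add[OF 1(1,2)] 1(3)] rep_add'[OF 1(1,2)]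
          rep_add'[OF 1(1) add[OF 1(2,3)]] rep_add'[OF 1(2,3)]
          AE_fibre[OF DW[OF 1(1)]] AE_fibre[OF DW[OF 1(2)]] AE_fibre[OF DW[OF 1(3)]]
        by eventually_elim (simp add: complex_inner_space.add_assoc)
    qed (use 1 in \<open>simp_all add: DW add\<close>)
  next
    case (2 A B)
    show ?case
    proof (rule class_eqI)
      show "AE x in M. rep (vadd W A B) x = rep (vadd W B A) x"
        using rep_add'[OF 2(1,2)] rep_add'[OF 2(2,1)]
          AE_fibre[OF DW[OF 2(1)]] AE_fibre[OF DW[OF 2(2)]]
        by eventually_elim (metis complex_inner_space.add_commute)
    qed (use 2 in \<open>simp_all add: DW add\<close>)
  next
    case (3 A)
    show ?case
    proof (rule class_eqI)
      show "AE x in M. rep (vadd W A (vzero W)) x = rep A x"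
        using rep_add'[OF 3 zero] rep_zero' AE_fibre[OF DW[OF 3]]
        by eventually_elim (simp add: complex_inner_space.add_zero)
    qed (use 3 in \<open>simp_all add: DW add zero\<close>)
  next
    case (4 A)
    have "vdiff W A A = vzero W"
    proof (rule class_eqI)
      show "AE x in M. rep (vdiff W A A) x = rep (vzero W) x"
        unfolding vdiff_def
        using rep_add'[OF 4 scale[OF 4, of "- 1"]] rep_scale'[OF 4, of "- 1"] rep_zero'
          AE_fibre[OF DW[OF 4]]
        by eventually_elim (simp add: complex_inner_space.diff_eq_zero flip: vdiff_def)
    qed (use 4 in \<open>simp_all add: DW add scale zero vdiff_def\<close>)
    then show ?case using scale[OF 4, of "- 1"] by (auto simp: vdiff_def)
  next
    case (5 A)
    show ?case
    proof (rule class_eqI)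
      show "AE x in M. rep (vscale W 1 A) x = rep A x"
        using rep_scale'[OF 5, of 1] AE_fibre[OF DW[OF 5]]
        by eventually_elim (simp add: complex_inner_space.scale_one)
    qed (use 5 in \<open>simp_all add: DW scale\<close>)
  next
    case (6 A c d)
    show ?case
    proof (rule class_eqI)
      show "AE x in M. rep (vscale W c (vscale W d A)) x = rep (vscale W (c * d) A) x"
        using rep_scale'[OF scale[OF 6, of d], of c] rep_scale'[OF 6, of d]
          rep_scale'[OF 6, of "c * d"] AE_fibre[OF DW[OF 6]]
        by eventually_elim (simp add: complex_inner_space.scale_scale)
    qed (use 6 in \<open>simp_all add: DW scale\<close>)
  next
    case (7 A B c)
    show ?case
    proof (rule class_eqI)
      show "AE x in M. rep (vscale W c (vadd W A B)) x = rep (vadd W (vscale W c A) (vscale W c B)) x"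
        using rep_scale'[OF add[OF 7], of c] rep_add'[OF 7] rep_scale'[OF 7(1), of c]
          rep_scale'[OF 7(2), of c] rep_add'[OF scale[OF 7(1), of c] scale[OF 7(2), of c]]
          AE_fibre[OF DW[OF 7(1)]] AE_fibre[OF DW[OF 7(2)]]
        by eventually_elim (simp add: complex_inner_space.scale_add_right)
    qed (use 7 in \<open>simp_all add: DW scale add\<close>)
  next
    case (8 A c d)
    show ?case
    proof (rule class_eqI)
      show "AE x in M. rep (vscale W (c + d) A) x = rep (vadd W (vscale W c A) (vscale W d A)) x"
        using rep_scale'[OF 8, of c] rep_scale'[OF 8, of d] rep_scale'[OF 8, of "c + d"]
          rep_add'[OF scale[OF 8, of c] scale[OF 8, of d]] AE_fibre[OF DW[OF 8]]
        by eventually_elim (simp add: complex_inner_space.scale_add_left)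
    qed (use 8 in \<open>simp_all add: DW scale add\<close>)
  next
    case (9 A B C)
    note int = inner_integrable[OF DW[OF 9(1)] DW[OF 9(3)]] inner_integrable[OF DW[OF 9(2)] DW[OF 9(3)]]
    have "vinner W (vadd W A B) C
      = (\<integral>x. vinner (F x) (rep A x) (rep C x) + vinner (F x) (rep B x) (rep C x) \<partial>M)"
    proof (rule inner_cong)
      show "AE x in M. vinner (F x) (rep (vadd W A B) x) (rep C x)
        = vinner (F x) (rep A x) (rep C x) + vinner (F x) (rep B x) (rep C x)"
        using rep_add'[OF 9(1,2)]
          AE_fibre[OF DW[OF 9(1)]] AE_fibre[OF DW[OF 9(2)]] AE_fibre[OF DW[OF 9(3)]]
        by eventually_elim (simp add: complex_inner_space.inner_add)
    qed (use 9 int in \<open>auto simp: DW add\<close>)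
    then show ?case by (simp add: Bochner_Integration.integral_add[OF int] flip: inner_class)
  next
    case (10 A B c)
    note int = inner_integrable[OF DW[OF 10(1)] DW[OF 10(2)]]
    have "vinner W (vscale W c A) B = (\<integral>x. c * vinner (F x) (rep A x) (rep B x) \<partial>M)"
    proof (rule inner_cong)
      show "AE x in M. vinner (F x) (rep (vscale W c A) x) (rep B x)
        = c * vinner (F x) (rep A x) (rep B x)"
        using rep_scale'[OF 10(1), of c] AE_fibre[OF DW[OF 10(1)]] AE_fibre[OF DW[OF 10(2)]]
        by eventually_elim (simp add: complex_inner_space.inner_scale)
    qed (use 10 int in \<open>auto simp: DW scale\<close>)
    then show ?case by (simp flip: inner_class)
  next
    case (11 A B)
    note int = inner_integrable[OF DW[OF 11(1)] DW[OF 11(2)]]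
    have "vinner W B A = (\<integral>x. cnj (vinner (F x) (rep A x) (rep B x)) \<partial>M)"
    proof (rule inner_cong)
      show "AE x in M. vinner (F x) (rep B x) (rep A x) = cnj (vinner (F x) (rep A x) (rep B x))"
        using AE_fibre[OF DW[OF 11(1)]] AE_fibre[OF DW[OF 11(2)]]
        by eventually_elim (metis complex_inner_space.inner_commute)
      show "(\<lambda>x. cnj (vinner (F x) (rep A x) (rep B x))) \<in> borel_measurable M"
        using int by (intro borel_measurable_integrable integrable_cnj)
    qed (use 11 in \<open>auto simp: DW\<close>)
    then show ?case by (simp flip: inner_class)
  next
    case (12 A)
    then show ?case by (simp add: inner_self_class DW integral_nonneg_AE)
  next
    case (13 A)
    have "(\<integral>x. (vnorm (F x) (rep A x))\<^sup>2 \<partial>M) = 0"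
      using 13 by (simp add: inner_self_class DW)
    then have "AE x in M. (vnorm (F x) (rep A x))\<^sup>2 = 0"
      using norm_sq_integrable[OF rep_in_S[OF DW[OF 13(1)]]]
      by (subst (asm) integral_nonneg_eq_0_iff_AE) auto
    then have "AE x in M. rep A x = rep (vzero W) x"
      using rep_zero' AE_fibre[OF DW[OF 13(1)]]
      by eventually_elim (simp add: complex_inner_space.vnorm_eq_zero)
    then show ?case by (intro class_eqI) (simp_all add: DW 13 zero)
  qed
qed

end

lemma complex_inner_space_complex_line: "complex_inner_space complex_line"
proof (unfold_locales, goal_cases)
  case (7 u)
  then show ?case by (intro bexI[of _ "- u"]) (simp_all add: complex_line_def)
qed (auto simp: complex_line_def algebra_simps)

lemma vdiff_complex_line: "vdiff complex_line z w = z - w"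
  by (simp add: vdiff_def complex_line_def)

interpretation L2: square_integrable_field M "\<lambda>_. complex_line" "sq_integrable_functions M"
  rewrites "class_space M (\<lambda>_. complex_line) (sq_integrable_functions M) = L2 M" for M :: "'x measure"
proof -
  show "square_integrable_field M (\<lambda>_. complex_line) (sq_integrable_functions M)"
  proof (rule square_integrable_field.intro)
    show "integrable M (\<lambda>x. (vnorm complex_line (f x))\<^sup>2)"
      if "f \<in> sq_integrable_functions M" for f
      using that by (simp add: vnorm_complex_line sq_integrable_functions_def)
    show "(\<lambda>x. vinner complex_line (f x) (g x)) \<in> borel_measurable M"
      if "f \<in> sq_integrable_functions M" "g \<in> sq_integrable_functions M" for f g
      using that borel_measurable_continuous_onI[OF continuous_on_cnj[OF continuous_on_id]]
      by (auto simp: sq_integrable_functions_def complex_line_def intro!: borel_measurable_times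
          elim: measurable_compose)
  qed (simp_all add: complex_inner_space_complex_line, simp add: complex_line_def)
qed (simp add: L2_def)


section \<open>Measurable sections of a Hermitian vector bundle\<close>

lemma
  assumes "sets M = sets (borel_of X)"
  shows space_eq_topspace: "space M = topspace X"
    and open_measurable: "openin X U \<Longrightarrow> U \<in> sets M"
proof -
  have sub: "{U. openin X U} \<subseteq> Pow (topspace X)" by (auto dest: openin_subset)
  show "space M = topspace X"
    using sets_eq_imp_space_eq[OF assms] space_measure_of[OF sub]
    by (simp add: borel_of_def)
  show "U \<in> sets M" if "openin X U"
    using that sets_measure_of[OF sub] unfolding assms by (auto simp: borel_of_def)
qed

context hermitian_vector_bundle
begin

lemma open_vimage_proj: "openin X W \<Longrightarrow> openin (total_space E) {e \<in> topspace (total_space E). proj E e \<in> W}"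
  using proj_continuous by (rule openin_continuous_map_preimage)

text \<open>
  The third condition says that pairing with the local section \<open>y \<mapsto> \<phi> (y, h)\<close> is continuous on the part
  of the bundle over \<open>W\<close>, the fourth that the zero section is continuous on \<open>W\<close>.
\<close>

definition frame_on :: "'x set \<Rightarrow> ('x \<times> 'h \<Rightarrow> 'e) \<Rightarrow> bool" where
  "frame_on W \<phi> \<longleftrightarrow> openin X W \<and>
     (\<forall>y\<in>W. isometric_isomorphism H (fibre E y) (\<lambda>h. \<phi> (y, h))) \<and>
     (\<forall>h\<in>vecs H. \<forall>G. open G \<longrightarrow> openin (total_space E) {e \<in> topspace (total_space E).
        proj E e \<in> W \<and> vinner (fibre E (proj E e)) e (\<phi> (proj E e, h)) \<in> G}) \<and>
     (\<forall>Q. openin (total_space E) Q \<longrightarrow> openin X {y \<in> W. \<phi> (y, vzero H) \<in> Q})"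

text \<open>
  A trivialization is isometric on fibres, so in its coordinates pairing with \<open>y \<mapsto> \<phi> (y, h)\<close> is pairing
  with the fixed vector \<open>h\<close> of the model space. Passing to an open \<open>W\<close> inside the trivializing
  neighbourhood turns relatively open sets into open ones.
\<close>

lemma local_frame:
  assumes "x \<in> topspace X"
  obtains W \<phi> where "x \<in> W" "frame_on W \<phi>"
proof -
  interpret H: complex_inner_space H by (rule model_inner_space)
  obtain U \<phi> W where U: "U \<subseteq> topspace X" and W: "openin X W" "x \<in> W" "W \<subseteq> U"
    and homeo: "homeomorphic_map (prod_topology (subtopology X U) (norm_topology H))
        (subtopology (total_space E) {e \<in> topspace (total_space E). proj E e \<in> U}) \<phi>"
    and iso: "\<And>y. y \<in> U \<Longrightarrow> isometric_isomorphism H (fibre E y) (\<lambda>h. \<phi> (y, h))"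
    using locally_trivial[OF assms] by blast
  let ?EU = "{e \<in> topspace (total_space E). proj E e \<in> U}"
  have fib: "\<phi> (y, h) \<in> topspace (total_space E)" "proj E (\<phi> (y, h)) = y"
    "\<phi> (y, h) \<in> vecs (fibre E y)"
    if "y \<in> U" "h \<in> vecs H" for y h
  proof -
    show *: "\<phi> (y, h) \<in> vecs (fibre E y)"
      using iso[OF that(1)] that(2) by (auto simp: isometric_isomorphism_def bij_betw_def)
    show "\<phi> (y, h) \<in> topspace (total_space E)" "proj E (\<phi> (y, h)) = y"
      using * fibre_carrier[of y] U that(1) by auto
  qed
  have pairing: "openin (total_space E) {e \<in> topspace (total_space E). proj E e \<in> W \<and>
      vinner (fibre E (proj E e)) e (\<phi> (proj E e, h)) \<in> G}" (is "openin _ ?T")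
    if h: "h \<in> vecs H" and G: "open G" for h G
  proof -
    let ?P = "W \<times> {k \<in> vecs H. vinner H k h \<in> G}"
    have "?T = \<phi> ` ?P"
    proof
      show "?T \<subseteq> \<phi> ` ?P"
      proof
        fix e assume e: "e \<in> ?T"
        let ?y = "proj E e"
        have y: "?y \<in> U" "?y \<in> topspace X" using e W U by auto
        have "e \<in> vecs (fibre E ?y)" using e fibre_carrier[OF y(2)] by simp
        then have "e \<in> (\<lambda>h. \<phi> (?y, h)) ` vecs H"
          using iso[OF y(1)] by (simp add: isometric_isomorphism_def bij_betw_def)
        then obtain k where k: "k \<in> vecs H" "e = \<phi> (?y, k)" by (rule imageE)
        have "vinner (fibre E ?y) (\<phi> (?y, k)) (\<phi> (?y, h)) = vinner H k h"
          using isometric_isomorphism_inner[OF model_inner_space fibre_inner_space[OF y(2)]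
              iso[OF y(1)] k(1) h] .
        then have "vinner H k h \<in> G" using e k(2) by simp
        then show "e \<in> \<phi> ` ?P" using e k by (intro image_eqI[of _ _ "(?y, k)"]) auto
      qed
      show "\<phi> ` ?P \<subseteq> ?T"
      proof
        fix e assume "e \<in> \<phi> ` ?P"
        then obtain y k where yk: "y \<in> W" "k \<in> vecs H" "vinner H k h \<in> G" "e = \<phi> (y, k)" by auto
        have y: "y \<in> U" "y \<in> topspace X" using yk(1) W U by auto
        have "vinner (fibre E y) (\<phi> (y, k)) (\<phi> (y, h)) = vinner H k h"
          using isometric_isomorphism_inner[OF model_inner_space fibre_inner_space[OF y(2)]
              iso[OF y(1)] yk(2) h] .
        then show "e \<in> ?T" using yk fib[OF y(1) yk(2)] by simp
      qed
    qed
    moreover have "openin (subtopology (total_space E) ?EU) (\<phi> ` ?P)"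
    proof -
      have "openin (subtopology X U) W"
        using W by (auto simp: openin_subtopology)
      then have "openin (prod_topology (subtopology X U) (norm_topology H)) ?P"
        using H.openin_inner_preimage[OF h G] by (simp add: openin_prod_Times_iff)
      then show ?thesis
        using homeomorphic_imp_open_map[OF homeo] by (simp add: open_map_def)
    qed
    ultimately obtain Q where Q: "openin (total_space E) Q" "?T = Q \<inter> ?EU"
      by (auto simp: openin_subtopology)
    then have "?T = Q \<inter> {e \<in> topspace (total_space E). proj E e \<in> W}"
      using W by blast
    then show ?thesis using Q(1) open_vimage_proj[OF W(1)] by (metis openin_Int)
  qed
  have zero: "openin X {y \<in> W. \<phi> (y, vzero H) \<in> Q}" if Q: "openin (total_space E) Q" for Q
  proof -
    have "continuous_map (subtopology X U) (prod_topology (subtopology X U) (norm_topology H))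
        (\<lambda>y. (y, vzero H))"
      by (simp add: continuous_map_pairedI H.topspace_norm_topology H.zero_closed)
    moreover have "continuous_map (prod_topology (subtopology X U) (norm_topology H)) (total_space E) \<phi>"
      using homeomorphic_imp_continuous_map[OF homeo] by (simp add: continuous_map_in_subtopology)
    ultimately have "continuous_map (subtopology X U) (total_space E) (\<lambda>y. \<phi> (y, vzero H))"
      using continuous_map_compose by (fastforce simp: o_def)
    then have "openin (subtopology X U) {y \<in> topspace (subtopology X U). \<phi> (y, vzero H) \<in> Q}"
      using Q by (rule openin_continuous_map_preimage)
    then obtain R where R: "openin X R" "{y \<in> topspace (subtopology X U). \<phi> (y, vzero H) \<in> Q} = R \<inter> U"
      by (auto simp: openin_subtopology)
    have "{y \<in> W. \<phi> (y, vzero H) \<in> Q} = R \<inter> W"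
      using R(2) W(3) U by auto
    then show ?thesis using R(1) W(1) by auto
  qed
  show ?thesis
  proof (rule that[OF W(2)])
    have "isometric_isomorphism H (fibre E y) (\<lambda>h. \<phi> (y, h))" if "y \<in> W" for y
      using iso that W(3) by blast
    then show "frame_on W \<phi>"
      unfolding frame_on_def using W(1) pairing zero by blast
  qed
qed

lemma iso_zero:
  assumes y: "y \<in> topspace X" and f: "isometric_isomorphism H (fibre E y) f"
  shows "f (vzero H) = vzero (fibre E y)"
proof -
  interpret H: complex_inner_space H by (rule model_inner_space)
  interpret Fy: complex_inner_space "fibre E y" by (rule fibre_inner_space[OF y])
  have "f (vzero H) \<in> vecs (fibre E y)" "f (vscale H 0 (vzero H)) = vscale (fibre E y) 0 (f (vzero H))"
    using f H.zero_closed by (auto simp: isometric_isomorphism_def bij_betw_def)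
  then show ?thesis
    using H.scale_zero_left[OF H.zero_closed] Fy.scale_zero_left by simp
qed

lemma zero_section_measurable:
  assumes M: "sets M = sets (borel_of X)"
  shows "(\<lambda>x. vzero (fibre E x)) \<in> measurable M (borel_of (total_space E))"
  unfolding borel_of_def
proof (rule measurable_measure_of)
  show "{U. openin (total_space E) U} \<subseteq> Pow (topspace (total_space E))"
    by (auto dest: openin_subset)
  show "(\<lambda>x. vzero (fibre E x)) \<in> space M \<rightarrow> topspace (total_space E)"
    using space_eq_topspace[OF M] fibre_carrier fibre_inner_space complex_inner_space.zero_closed
    by fastforce
  fix Q assume "Q \<in> {U. openin (total_space E) U}"
  then have Q: "openin (total_space E) Q" by simp
  have "openin X {x \<in> topspace X. vzero (fibre E x) \<in> Q}"
  proof (subst openin_subopen, safe)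
    fix x assume x: "x \<in> topspace X" and xQ: "vzero (fibre E x) \<in> Q"
    obtain W \<phi> where "x \<in> W" "frame_on W \<phi>"
      by (rule local_frame[OF x])
    then have W: "openin X W" "x \<in> W"
      "\<And>y. y \<in> W \<Longrightarrow> isometric_isomorphism H (fibre E y) (\<lambda>h. \<phi> (y, h))"
      "openin X {y \<in> W. \<phi> (y, vzero H) \<in> Q}"
      using Q by (auto simp: frame_on_def)
    have W': "y \<in> topspace X" if "y \<in> W" for y using that openin_subset[OF W(1)] by blast
    have "{y \<in> W. \<phi> (y, vzero H) \<in> Q} = {y \<in> W. vzero (fibre E y) \<in> Q}"
      using iso_zero[OF W' W(3)] by auto
    then show "\<exists>T. openin X T \<and> x \<in> T \<and> T \<subseteq> {x \<in> topspace X. vzero (fibre E x) \<in> Q}"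
      using W(2) W(4) W' xQ by (intro exI[of _ "{y \<in> W. \<phi> (y, vzero H) \<in> Q}"]) auto
  qed
  then have "{x \<in> topspace X. vzero (fibre E x) \<in> Q} \<in> sets M"
    by (rule open_measurable[OF M])
  moreover have "(\<lambda>x. vzero (fibre E x)) -` Q \<inter> space M = {x \<in> topspace X. vzero (fibre E x) \<in> Q}"
    using space_eq_topspace[OF M] by auto
  ultimately show "(\<lambda>x. vzero (fibre E x)) -` Q \<inter> space M \<in> sets M" by simp
qed

text \<open>
  Over a trivializing open set, Parseval's identity in the model space expresses the inner product of
  two sections by finitely many coordinates, and each coordinate is a continuous function on the
  bundle composed with a section. Countably many trivializing open sets suffice to cover the base.
\<close>

lemma section_inner_measurable:
  assumes X: "Lindelof_space X" and M: "sets M = sets (borel_of X)"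
    and \<xi>: "\<xi> \<in> measurable M (borel_of (total_space E))" "\<And>x. x \<in> space M \<Longrightarrow> proj E (\<xi> x) = x"
    and \<eta>: "\<eta> \<in> measurable M (borel_of (total_space E))" "\<And>x. x \<in> space M \<Longrightarrow> proj E (\<eta> x) = x"
  shows "(\<lambda>x. vinner (fibre E x) (\<xi> x) (\<eta> x)) \<in> borel_measurable M"
proof -
  interpret H: complex_inner_space H by (rule model_inner_space)
  note space = space_eq_topspace[OF M]
  obtain B where B: "finite B" "B \<subseteq> vecs H"
    "\<And>u v. \<lbrakk>u \<in> vecs H; v \<in> vecs H\<rbrakk> \<Longrightarrow> vinner H u v = (\<Sum>e\<in>B. vinner H u e * vinner H e v)"
    using H.finite_Parseval_frame[OF model_finite_dimensional] by blast
  let ?f = "\<lambda>x. vinner (fibre E x) (\<xi> x) (\<eta> x)"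
  have local: "\<exists>W. openin X W \<and> x \<in> W \<and> ?f \<in> borel_measurable (restrict_space M W)"
    if x: "x \<in> topspace X" for x
  proof -
    obtain W \<phi> where "x \<in> W" "frame_on W \<phi>"
      by (rule local_frame[OF x])
    then have W: "openin X W" "x \<in> W"
      and iso: "\<And>y. y \<in> W \<Longrightarrow> isometric_isomorphism H (fibre E y) (\<lambda>h. \<phi> (y, h))"
      and pairing: "\<And>h G. \<lbrakk>h \<in> vecs H; open G\<rbrakk> \<Longrightarrow> openin (total_space E)
        {e \<in> topspace (total_space E). proj E e \<in> W \<and> vinner (fibre E (proj E e)) e (\<phi> (proj E e, h)) \<in> G}"
      by (auto simp: frame_on_def)
    have WX: "W \<subseteq> topspace X" by (rule openin_subset[OF W(1)])
    have WM: "W \<in> sets M" by (rule open_measurable[OF M W(1)])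
    have coordinate: "(\<lambda>y. vinner (fibre E y) (\<zeta> y) (\<phi> (y, h))) \<in> borel_measurable (restrict_space M W)"
      if \<zeta>: "\<zeta> \<in> measurable M (borel_of (total_space E))" "\<And>y. y \<in> space M \<Longrightarrow> proj E (\<zeta> y) = y"
        and h: "h \<in> vecs H" for \<zeta> h
    proof (rule borel_measurableI)
      fix G :: "complex set" assume G: "open G"
      let ?T = "{e \<in> topspace (total_space E). proj E e \<in> W \<and>
        vinner (fibre E (proj E e)) e (\<phi> (proj E e, h)) \<in> G}"
      have T: "?T \<in> sets (borel_of (total_space E))"
        using pairing[OF h G] by (intro open_measurable[OF refl])
      have "\<zeta> y \<in> topspace (total_space E)" if "y \<in> W" for y
        using measurable_space[OF \<zeta>(1), of y] that WX space space_eq_topspace[OF refl, of "total_space E"]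
        by auto
      then have "(\<lambda>y. vinner (fibre E y) (\<zeta> y) (\<phi> (y, h))) -` G \<inter> space (restrict_space M W)
        = \<zeta> -` ?T \<inter> space M"
        using WX \<zeta>(2) by (auto simp: space_restrict_space space)
      also have "\<dots> \<in> sets (restrict_space M W)"
      proof (subst sets_restrict_space_iff)
        show "W \<inter> space M \<in> sets M" using WM by auto
        show "\<zeta> -` ?T \<inter> space M \<subseteq> W \<and> \<zeta> -` ?T \<inter> space M \<in> sets M"
          using \<zeta>(2) measurable_sets[OF \<zeta>(1) T] by auto
      qed
      finally show "(\<lambda>y. vinner (fibre E y) (\<zeta> y) (\<phi> (y, h))) -` G \<inter> space (restrict_space M W)
        \<in> sets (restrict_space M W)" .
    qed
    have expand: "?f y = (\<Sum>e\<in>B. vinner (fibre E y) (\<xi> y) (\<phi> (y, e)) * cnj (vinner (fibre E y) (\<eta> y) (\<phi> (y, e))))"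
      if y: "y \<in> W" for y
    proof -
      have yX: "y \<in> topspace X" using y WX by blast
      interpret Fy: complex_inner_space "fibre E y" by (rule fibre_inner_space[OF yX])
      have in_fibre: "\<zeta> y \<in> vecs (fibre E y)"
        if "\<zeta> \<in> measurable M (borel_of (total_space E))" "proj E (\<zeta> y) = y" for \<zeta>
        using measurable_space[OF that(1), of y] that(2) yX space fibre_carrier[OF yX]
          space_eq_topspace[OF refl, of "total_space E"] by auto
      have "\<xi> y \<in> (\<lambda>h. \<phi> (y, h)) ` vecs H" "\<eta> y \<in> (\<lambda>h. \<phi> (y, h)) ` vecs H"
        using in_fibre[OF \<xi>(1)] in_fibre[OF \<eta>(1)] \<xi>(2)[of y] \<eta>(2)[of y] yX space iso[OF y]
        unfolding isometric_isomorphism_def bij_betw_def by simp_all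
      then obtain u v where u: "u \<in> vecs H" "\<xi> y = \<phi> (y, u)" and v: "v \<in> vecs H" "\<eta> y = \<phi> (y, v)"
        by blast
      have isoi: "vinner (fibre E y) (\<phi> (y, h)) (\<phi> (y, k)) = vinner H h k"
        if "h \<in> vecs H" "k \<in> vecs H" for h k
        using isometric_isomorphism_inner[OF model_inner_space fibre_inner_space[OF yX] iso[OF y] that] .
      have "?f y = (\<Sum>e\<in>B. vinner H u e * vinner H e v)"
        using u v B(3) by (simp add: isoi)
      also have "\<dots> = (\<Sum>e\<in>B. vinner H u e * cnj (vinner H v e))"
        using B(2) v(1) by (intro sum.cong refl) (metis H.inner_commute subsetD)
      also have "\<dots> = (\<Sum>e\<in>B. vinner (fibre E y) (\<xi> y) (\<phi> (y, e)) * cnj (vinner (fibre E y) (\<eta> y) (\<phi> (y, e))))"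
        using B(2) u v by (intro sum.cong refl) (auto simp: isoi)
      finally show ?thesis .
    qed
    have cnj_meas: "cnj \<in> borel_measurable borel"
      by (intro borel_measurable_continuous_onI continuous_on_cnj continuous_on_id)
    have "(\<lambda>y. \<Sum>e\<in>B. vinner (fibre E y) (\<xi> y) (\<phi> (y, e)) * cnj (vinner (fibre E y) (\<eta> y) (\<phi> (y, e))))
      \<in> borel_measurable (restrict_space M W)"
      using B(2) by (intro borel_measurable_sum borel_measurable_times coordinate \<xi> \<eta>
          measurable_compose[OF coordinate[OF \<eta>] cnj_meas]) auto
    then have "?f \<in> borel_measurable (restrict_space M W)"
      by (rule measurable_cong[THEN iffD2, rotated]) (auto simp: space_restrict_space expand)
    then show ?thesis using W by blast
  qed
  define \<U> where "\<U> = {W. openin X W \<and> ?f \<in> borel_measurable (restrict_space M W)}"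
  have "\<Union>\<U> = topspace X"
    using local by (auto simp: \<U>_def dest: openin_subset)
  then obtain \<V> where \<V>: "countable \<V>" "\<V> \<subseteq> \<U>" "\<Union>\<V> = topspace X"
    using X unfolding Lindelof_space_def by (metis (mono_tags, lifting) \<U>_def mem_Collect_eq)
  show ?thesis
  proof (rule measurable_piecewise_restrict[OF \<V>(1)])
    show "space M \<subseteq> \<Union>\<V>" using \<V> space by simp
    fix W assume "W \<in> \<V>"
    then have W: "openin X W" "?f \<in> borel_measurable (restrict_space M W)"
      using \<V>(2) by (auto simp: \<U>_def)
    then show "?f \<in> borel_measurable (restrict_space M W)" "W \<inter> space M \<in> sets M"
      using open_measurable[OF M W(1)] by auto
  qed
qed

lemma section_in_fibre:
  assumes M: "sets M = sets (borel_of X)"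
    and \<xi>: "\<xi> \<in> sq_integrable_sections M E" and x: "x \<in> space M"
  shows "\<xi> x \<in> vecs (fibre E x)"
  using \<xi> x fibre_carrier[of x] measurable_space[of \<xi> M "borel_of (total_space E)" x]
    space_eq_topspace[OF M] space_eq_topspace[OF refl, of "total_space E"]
  by (auto simp: sq_integrable_sections_def)

theorem square_integrable_field_sections:
  assumes X: "Lindelof_space X" and M: "sets M = sets (borel_of X)"
  shows "square_integrable_field M (fibre E) (sq_integrable_sections M E)"
proof (rule square_integrable_field.intro)
  show "complex_inner_space (fibre E x)" if "x \<in> space M" for x
    using that fibre_inner_space space_eq_topspace[OF M] by simp
  show "(\<lambda>x. vinner (fibre E x) (\<xi> x) (\<eta> x)) \<in> borel_measurable M"
    if "\<xi> \<in> sq_integrable_sections M E" "\<eta> \<in> sq_integrable_sections M E" for \<xi> \<eta>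
    using that by (intro section_inner_measurable[OF X M]) (auto simp: sq_integrable_sections_def)
qed (auto simp: section_in_fibre[OF M] sq_integrable_sections_def)

end


section \<open>Compactly supported classes of sections\<close>

locale bundle_L2 = hermitian_vector_bundle X E H
  for X :: "'x topology" and E :: "('x, 'e) vbundle" and H :: "'h inner_structure" +
  fixes M :: "'x measure"
  assumes Lindelof: "Lindelof_space X"
    and sets_M: "sets M = sets (borel_of X)"
begin

sublocale sections: square_integrable_field M "fibre E" "sq_integrable_sections M E"
  rewrites "class_space M (fibre E) (sq_integrable_sections M E) = L2_sections M E"
  by (rule square_integrable_field_sections[OF Lindelof sets_M]) (simp add: L2_sections_def)

text \<open>
  A representative that vanishes outside \<open>K\<close> vanishes on a measurable set \<open>Z\<close> that contains the complement
  of \<open>K\<close>, and conversely an arbitrary representative can be changed to zero on such a set. The set \<open>Z\<close>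
  is there because compact sets need not be measurable in a space without separation properties; in
  this form supports of sums can be computed with arbitrary representatives.
\<close>

lemma compact_support_iff:
  assumes A: "A \<in> vecs (L2_sections M E)"
  shows "A \<in> L2_sections_compact X M E \<longleftrightarrow>
    (\<exists>K Z. compactin X K \<and> Z \<in> sets M \<and> topspace X - K \<subseteq> Z \<and>
      (AE x in M. x \<in> Z \<longrightarrow> rep A x = vzero (fibre E x)))" (is "?l \<longleftrightarrow> ?r")
proof
  note space = space_eq_topspace[OF sets_M]
  assume ?l
  then obtain K \<xi> where K: "compactin X K" and \<xi>: "\<xi> \<in> A"
    and off: "\<And>x. x \<in> topspace X - K \<Longrightarrow> \<xi> x = vzero (fibre E x)"
    unfolding L2_sections_compact_def by blast
  note \<xi>S = sections.mem_classD[OF A \<xi>]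
  let ?Z = "{x \<in> space M. vnorm (fibre E x) (\<xi> x) = 0}"
  have "?Z \<in> sets M" using sections.norm_measurable[OF \<xi>S(1)] by measurable
  moreover have "topspace X - K \<subseteq> ?Z"
    using off fibre_inner_space space by (auto simp: complex_inner_space.vnorm_zero)
  moreover have "AE x in M. x \<in> ?Z \<longrightarrow> rep A x = vzero (fibre E x)"
    using \<xi>S(2) sections.AE_fibre[OF A]
    by eventually_elim (auto simp: complex_inner_space.vnorm_eq_zero)
  ultimately show ?r using K by blast
next
  note space = space_eq_topspace[OF sets_M]
  assume ?r
  then obtain K Z where K: "compactin X K" and Z: "Z \<in> sets M" "topspace X - K \<subseteq> Z"
    and off: "AE x in M. x \<in> Z \<longrightarrow> rep A x = vzero (fibre E x)" by blast
  define \<zeta> where "\<zeta> x = (if x \<in> Z then vzero (fibre E x) else rep A x)" for x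
  have repA: "rep A \<in> sq_integrable_sections M E" by (rule sections.rep_in_S[OF A])
  have "\<zeta> \<in> measurable M (borel_of (total_space E))"
    unfolding \<zeta>_def using Z(1) repA zero_section_measurable[OF sets_M]
    by (auto simp: sq_integrable_sections_def intro!: measurable_If_set)
  moreover have "proj E (\<zeta> x) = x" if "x \<in> space M" for x
  proof -
    have "vzero (fibre E x) \<in> vecs (fibre E x)"
      using that space fibre_inner_space by (auto intro: complex_inner_space.zero_closed)
    then show ?thesis
      using that repA fibre_carrier[of x] space by (auto simp: \<zeta>_def sq_integrable_sections_def)
  qed
  moreover have "integrable M (\<lambda>x. (vnorm (fibre E x) (\<zeta> x))\<^sup>2)"
  proof -
    have "integrable M (\<lambda>x. indicator (space M - Z) x * (vnorm (fibre E x) (rep A x))\<^sup>2)"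
      using repA Z(1) by (intro integrable_mult_indicator[where 'b=real, simplified])
        (auto simp: sq_integrable_sections_def)
    then show ?thesis
      by (rule Bochner_Integration.integrable_cong[THEN iffD1, rotated 2])
        (auto simp: \<zeta>_def indicator_def complex_inner_space.vnorm_zero[OF fibre_inner_space] space)
  qed
  ultimately have "\<zeta> \<in> sq_integrable_sections M E"
    by (simp add: sq_integrable_sections_def)
  then have "\<zeta> \<in> A"
  proof (rule sections.mem_classI[OF A])
    show "AE x in M. \<zeta> x = rep A x" using off by eventually_elim (auto simp: \<zeta>_def)
  qed
  moreover have "\<forall>x\<in>topspace X - K. \<zeta> x = vzero (fibre E x)"
    using Z(2) by (auto simp: \<zeta>_def)
  ultimately show ?l using A K unfolding L2_sections_compact_def by blast
qed

lemma linear_subspace_compact_support: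
  assumes D: "linear_subspace (L2_sections M E) D"
  shows "linear_subspace (L2_sections M E) (D \<inter> L2_sections_compact X M E)"
  unfolding linear_subspace_def
proof (intro conjI ballI allI)
  note space = space_eq_topspace[OF sets_M]
  let ?V = "L2_sections M E" and ?C = "D \<inter> L2_sections_compact X M E"
  have DV: "A \<in> vecs ?V" if "A \<in> D" for A using D that by (auto simp: linear_subspace_def)
  have zero: "vzero ?V \<in> D" and add: "\<lbrakk>A \<in> D; B \<in> D\<rbrakk> \<Longrightarrow> vadd ?V A B \<in> D"
    and scale: "A \<in> D \<Longrightarrow> vscale ?V c A \<in> D" for A B c
    using D by (auto simp: linear_subspace_def)
  show "?C \<subseteq> vecs ?V" using DV by blast
  have "AE x in M. x \<in> space M \<longrightarrow> rep (vzero ?V) x = vzero (fibre E x)"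
    using sections.rep_zero[OF DV[OF zero]] by eventually_elim simp
  then have "vzero ?V \<in> L2_sections_compact X M E"
    unfolding compact_support_iff[OF DV[OF zero]] using space sets.top[of M]
    by - (rule exI[of _ "{}"], rule exI[of _ "space M"], auto)
  then show "vzero ?V \<in> ?C" using zero by blast
  fix A assume A: "A \<in> ?C"
  then obtain K Z where K: "compactin X K" "Z \<in> sets M" "topspace X - K \<subseteq> Z"
    and A0: "AE x in M. x \<in> Z \<longrightarrow> rep A x = vzero (fibre E x)"
    using compact_support_iff[of A] DV by blast
  have AD: "A \<in> D" using A by blast
  show "vscale ?V c A \<in> ?C" for c
  proof -
    have "AE x in M. x \<in> Z \<longrightarrow> rep (vscale ?V c A) x = vzero (fibre E x)"
      using sections.rep_scale[OF DV[OF scale[OF AD, of c]]] A0 sections.AE_fibre[OF DV[OF AD]]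
      by eventually_elim (auto simp: complex_inner_space.scale_zero_right)
    then show ?thesis
      using K scale[OF AD, of c] compact_support_iff[OF DV[OF scale[OF AD, of c]]] by blast
  qed
  fix B assume B: "B \<in> ?C"
  then obtain L Y where L: "compactin X L" "Y \<in> sets M" "topspace X - L \<subseteq> Y"
    and B0: "AE x in M. x \<in> Y \<longrightarrow> rep B x = vzero (fibre E x)"
    using compact_support_iff[of B] DV by blast
  have BD: "B \<in> D" using B by blast
  have "AE x in M. x \<in> Z \<inter> Y \<longrightarrow> rep (vadd ?V A B) x = vzero (fibre E x)"
    using sections.rep_add[OF DV[OF add[OF AD BD]]] A0 B0 sections.AE_fibre[OF DV[OF AD]]
    by eventually_elim
      (auto simp: complex_inner_space.add_zero complex_inner_space.zero_closed)
  moreover have "compactin X (K \<union> L)" "Z \<inter> Y \<in> sets M" "topspace X - (K \<union> L) \<subseteq> Z \<inter> Y"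
    using K L by (auto intro: compactin_Un)
  ultimately show "vadd ?V A B \<in> ?C"
    using add[OF AD BD] compact_support_iff[OF DV[OF add[OF AD BD]]] by blast
qed


section \<open>Paired sections\<close>

lemma rep_section_abs:
  assumes "section_abs M E A \<in> vecs (L2 M)"
  shows "AE x in M. rep (section_abs M E A) x = of_real (vnorm (fibre E x) (rep A x))"
  using L2.rep_class assms unfolding section_abs_def L2_def .

text \<open>
  The function \<open>|\<xi>| |\<eta>| - Re \<langle>\<xi>, \<eta>\<rangle>\<close> is nonnegative by the Cauchy-Schwarz inequality in the fibres, and
  pairedness makes its integral vanish. In the other direction, equality for the real part forces the
  imaginary part to vanish.
\<close>

lemma paired_iff_AE:
  assumes A: "A \<in> vecs (L2_sections M E)" and B: "B \<in> vecs (L2_sections M E)"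
    and absA: "section_abs M E A \<in> vecs (L2 M)" and absB: "section_abs M E B \<in> vecs (L2 M)"
  shows "paired M E A B \<longleftrightarrow> (AE x in M. Re (vinner (fibre E x) (rep A x) (rep B x))
    = vnorm (fibre E x) (rep A x) * vnorm (fibre E x) (rep B x))"
proof -
  let ?in = "\<lambda>x. vinner (fibre E x) (rep A x) (rep B x)"
  let ?n = "\<lambda>x. vnorm (fibre E x) (rep A x) * vnorm (fibre E x) (rep B x)"
  have n_meas: "?n \<in> borel_measurable M"
    using sections.norm_measurable[OF sections.rep_in_S[OF A]]
      sections.norm_measurable[OF sections.rep_in_S[OF B]] by measurable
  then have n_cmeas: "(\<lambda>x. complex_of_real (?n x)) \<in> borel_measurable M" by measurable
  have abs_eq: "AE x in M. vinner complex_line (rep (section_abs M E A) x) (rep (section_abs M E B) x)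
      = complex_of_real (?n x)"
    using rep_section_abs[OF absA] rep_section_abs[OF absB]
    by eventually_elim (simp add: complex_line_def)
  have "integrable M (\<lambda>x. complex_of_real (?n x))"
  proof (rule integrable_cong_AE_imp[OF L2.inner_integrable[OF absA absB]])
    show "(\<lambda>x. complex_of_real (?n x)) \<in> borel_measurable M" by (rule n_cmeas)
    show "AE x in M. vinner complex_line (rep (section_abs M E A) x) (rep (section_abs M E B) x)
        = complex_of_real (?n x)" by (rule abs_eq)
  qed
  then have n_int: "integrable M ?n" using integrable_Re by fastforce
  have abs_inner: "vinner (L2 M) (section_abs M E A) (section_abs M E B) = of_real (\<integral>x. ?n x \<partial>M)"
    using L2.inner_cong[OF absA absB n_cmeas abs_eq] by (simp only: integral_complex_of_real)
  have in_int: "integrable M ?in" by (rule sections.inner_integrable[OF A B])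
  have CS: "AE x in M. cmod (?in x) \<le> ?n x"
    using sections.AE_fibre[OF A] sections.AE_fibre[OF B]
    by eventually_elim (auto intro: complex_inner_space.Cauchy_Schwarz)
  show ?thesis
  proof
    assume "paired M E A B"
    then have "(\<integral>x. ?in x \<partial>M) = of_real (\<integral>x. ?n x \<partial>M)"
      by (simp add: paired_def abs_inner sections.inner_class)
    then have "(\<integral>x. Re (?in x) \<partial>M) = (\<integral>x. ?n x \<partial>M)"
      using in_int by simp
    then have "(\<integral>x. ?n x - Re (?in x) \<partial>M) = 0"
      using in_int n_int by simp
    moreover have "AE x in M. 0 \<le> ?n x - Re (?in x)"
      using CS by eventually_elim (metis complex_Re_le_cmod diff_ge_0_iff_ge order_trans)
    ultimately have "AE x in M. ?n x - Re (?in x) = 0"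
      using integral_nonneg_eq_0_iff_AE[of M "\<lambda>x. ?n x - Re (?in x)"] in_int n_int by simp
    then show "AE x in M. Re (?in x) = ?n x" by eventually_elim simp
  next
    assume "AE x in M. Re (?in x) = ?n x"
    then have "AE x in M. ?in x = complex_of_real (?n x)"
      using CS
    proof eventually_elim
      case (elim x)
      have "(cmod (?in x))\<^sup>2 \<le> (Re (?in x))\<^sup>2"
        using elim by (simp add: power_mono)
      then have "Im (?in x) = 0" by (simp add: cmod_power2)
      then show ?case using elim by (simp add: complex_eq_iff)
    qed
    then have "vinner (L2_sections M E) A B = (\<integral>x. complex_of_real (?n x) \<partial>M)"
      by (intro sections.inner_cong A B n_cmeas)
    then show "paired M E A B"
      by (simp only: paired_def abs_inner integral_complex_of_real)
  qed
qed

end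


section \<open>Truncation under the first Beurling-Deny criterion\<close>

locale Beurling_Deny_form = closed_form_space "L2 M" b m l
  for M :: "'x measure" and b m l +
  assumes Beurling_Deny: "first_Beurling_Deny M b"
begin

lemma dom_in_L2: "f \<in> fdom b \<Longrightarrow> f \<in> vecs (L2 M)"
  using dom_subspace by (auto simp: linear_subspace_def)

lemma abs_in_dom: "f \<in> fdom b \<Longrightarrow> L2_abs M f \<in> fdom b"
  using Beurling_Deny by (simp add: first_Beurling_Deny_def)

lemma rep_abs: "f \<in> fdom b \<Longrightarrow> AE x in M. rep (L2_abs M f) x = of_real (cmod (rep f x))"
  using L2.rep_class dom_in_L2[OF abs_in_dom] unfolding L2_abs_def L2_def .

text \<open>
  Taking absolute values preserves the \<open>L\<^sup>2\<close> norm, so the criterion carries over from the form to its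
  form norm.
\<close>

lemma form_norm_abs:
  assumes f: "f \<in> fdom b"
  shows "form_norm (L2 M) b m (L2_abs M f) \<le> form_norm (L2 M) b m f"
proof -
  have "(\<integral>x. (vnorm complex_line (rep (L2_abs M f) x))\<^sup>2 \<partial>M) = (\<integral>x. (vnorm complex_line (rep f x))\<^sup>2 \<partial>M)"
    using L2.norm_measurable[OF L2.rep_in_S[OF dom_in_L2[OF f]]]
      L2.norm_measurable[OF L2.rep_in_S[OF dom_in_L2[OF abs_in_dom[OF f]]]] rep_abs[OF f]
    by (intro integral_cong_AE) (auto simp: vnorm_complex_line)
  then have "vnorm (L2 M) (L2_abs M f) = vnorm (L2 M) f"
    by (simp add: L2.vnorm_class dom_in_L2 f abs_in_dom)
  moreover have "fval b (L2_abs M f) \<le> fval b f"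
    using Beurling_Deny f by (simp add: first_Beurling_Deny_def)
  ultimately show ?thesis by (simp add: form_norm_def)
qed

text \<open>
  With \<open>p = |g|\<close> and \<open>r = |u|\<close>, the minimum is \<open>(p + r - |p - r|) / 2\<close>, and no absolute value in this
  expression increases form norms.
\<close>

lemma min_abs_in_domain:
  assumes u: "u \<in> fdom b" and g: "g \<in> fdom b"
  obtains f where "f \<in> fdom b"
    "AE x in M. rep f x = of_real (min (cmod (rep g x)) (cmod (rep u x)))"
    "form_norm (L2 M) b m f \<le> form_norm (L2 M) b m g + form_norm (L2 M) b m u"
proof -
  let ?V = "L2 M" and ?N = "vnorm (form_space (L2 M) b m)"
  define p where "p = L2_abs M g"
  define r where "r = L2_abs M u"
  define h where "h = L2_abs M (vdiff ?V p r)"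
  define f where "f = vscale ?V (1/2) (vdiff ?V (vadd ?V p r) h)"
  have p: "p \<in> fdom b" and r: "r \<in> fdom b"
    using g u by (simp_all add: p_def r_def abs_in_dom)
  have pr: "vdiff ?V p r \<in> fdom b" "vadd ?V p r \<in> fdom b"
    using p r by (simp_all add: dom.diff_closed dom.add_closed)
  have h: "h \<in> fdom b" using pr by (simp add: h_def abs_in_dom)
  have prh: "vdiff ?V (vadd ?V p r) h \<in> fdom b"
    using pr h by (simp add: dom.diff_closed)
  have f: "f \<in> fdom b" using prh by (simp add: f_def dom.scale_closed)
  have diff: "AE x in M. rep (vdiff ?V s t) x = rep s x - rep t x"
    if "s \<in> fdom b" "t \<in> fdom b" for s t
    using L2.rep_diff[OF dom_in_L2[OF dom.diff_closed[OF that]] dom_in_L2[OF dom.scale_closed[OF that(2)]]]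
    by eventually_elim (simp add: vdiff_complex_line)
  have "AE x in M. rep f x = of_real (min (cmod (rep g x)) (cmod (rep u x)))"
    using L2.rep_scale[OF dom_in_L2[OF f[unfolded f_def]]] diff[OF pr(2) h]
      L2.rep_add[OF dom_in_L2[OF pr(2)]] rep_abs[OF pr(1)] diff[OF p r] rep_abs[OF g] rep_abs[OF u]
    unfolding f_def[symmetric] h_def[symmetric] p_def[symmetric] r_def[symmetric]
  proof eventually_elim
    case (elim x)
    have min: "(s + t - \<bar>s - t\<bar>) / 2 = min s t" for s t :: real by (simp add: min_def)
    have "rep f x = of_real ((cmod (rep g x) + cmod (rep u x) - \<bar>cmod (rep g x) - cmod (rep u x)\<bar>) / 2)"
      using elim by (simp add: complex_line_def) (simp flip: of_real_diff)
    then show ?case by (simp only: min)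
  qed
  moreover have "form_norm ?V b m f \<le> form_norm ?V b m g + form_norm ?V b m u"
  proof -
    have "?N h \<le> ?N (vdiff ?V p r)" "?N p \<le> ?N g" "?N r \<le> ?N u"
      using form_norm_abs[OF pr(1)] form_norm_abs[OF g] form_norm_abs[OF u] g u h p r pr
      by (simp_all add: form_norm_eq h_def p_def r_def)
    moreover have "?N f \<le> (?N (vadd ?V p r) + ?N h) / 2"
      unfolding f_def using form.vnorm_triangle_diff[OF pr(2) h] prh by (simp add: form.vnorm_scale)
    moreover have "?N (vadd ?V p r) \<le> ?N p + ?N r" "?N (vdiff ?V p r) \<le> ?N p + ?N r"
      by (rule form.vnorm_triangle[OF p r], rule form.vnorm_triangle_diff[OF p r])
    ultimately have "?N f \<le> ?N g + ?N u" by argo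
    then show ?thesis using f g u by (simp add: form_norm_eq)
  qed
  ultimately show ?thesis using that f by blast
qed

end


section \<open>Truncation of sections under domination\<close>

lemma le_add_sqrt_if_square_le:
  fixes t s C :: real
  assumes "t\<^sup>2 \<le> s * t + C" "0 \<le> s" "0 \<le> C"
  shows "t \<le> s + sqrt C"
proof (rule ccontr)
  assume "\<not> t \<le> s + sqrt C"
  then have t: "sqrt C < t - s" by simp
  have "C = sqrt C * sqrt C" using assms(3) by simp
  also have "\<dots> < (t - s) * (t - s)" using t assms(3) by (intro mult_strict_mono') auto
  also have "\<dots> \<le> t * (t - s)"
    using t assms(2) real_sqrt_ge_zero[OF assms(3)] by (intro mult_right_mono) linarith+
  finally show False using assms(1) by (simp add: power2_eq_square algebra_simps)
qed

locale dominated_forms =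
  bundle_L2 X E H M + A: closed_form_space "L2_sections M E" a ma la + B: Beurling_Deny_form M b mb lb
  for X :: "'x topology" and E :: "('x, 'e) vbundle" and H :: "'h inner_structure" and M :: "'x measure"
    and a b ma la mb lb +
  assumes dominated: "dominated M E a b"
begin

lemma dom_in_L2_sections: "\<xi> \<in> fdom a \<Longrightarrow> \<xi> \<in> vecs (L2_sections M E)"
  using A.dom_subspace by (auto simp: linear_subspace_def)

lemma section_abs_in_dom: "\<xi> \<in> fdom a \<Longrightarrow> section_abs M E \<xi> \<in> fdom b"
  using dominated by (simp add: dominated_def generalized_ideal_def)

text \<open>
  The truncation \<open>\<eta>\<close> comes from the generalized ideal property. Since \<open>\<langle>\<xi>, \<eta>\<rangle> = |\<xi>| |\<eta>|\<close> in almost every fibre,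
  \<open>|\<xi> - \<eta>|\<^sup>2 = (|\<xi>| - |\<eta>|)\<^sup>2\<close> and \<open>Re \<langle>\<xi> - \<eta>, \<eta>\<rangle> = (|\<xi>| - |\<eta>|) |\<eta>|\<close>; so \<open>\<xi> - \<eta>\<close> and \<open>\<eta>\<close> are paired and domination
  applies to them.
\<close>

lemma truncation:
  assumes \<xi>: "\<xi> \<in> fdom a" and f: "f \<in> fdom b"
    and f_le: "AE x in M. Im (rep f x) = 0 \<and> 0 \<le> Re (rep f x) \<and> Re (rep f x) \<le> vnorm (fibre E x) (rep \<xi> x)"
  obtains \<eta> where "\<eta> \<in> fdom a" "section_abs M E \<eta> = f"
    "section_abs M E (vdiff (L2_sections M E) \<xi> \<eta>) = vdiff (L2 M) (section_abs M E \<xi>) f"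
    "paired M E (vdiff (L2_sections M E) \<xi> \<eta>) \<eta>"
proof -
  let ?u = "section_abs M E \<xi>"
  have u: "?u \<in> fdom b" by (rule section_abs_in_dom[OF \<xi>])
  have abs: "AE x in M. rep (section_abs M E \<zeta>) x = of_real (vnorm (fibre E x) (rep \<zeta> x))"
    if "\<zeta> \<in> fdom a" for \<zeta>
    by (rule rep_section_abs[OF B.dom_in_L2[OF section_abs_in_dom[OF that]]])
  have "L2_le M (vzero (L2 M)) f"
    unfolding L2_le_def using L2.rep_zero[OF B.dom_in_L2[OF B.dom.zero_closed]] f_le
    by eventually_elim (simp add: complex_line_def)
  moreover have "L2_le M f ?u"
    unfolding L2_le_def using abs[OF \<xi>] f_le by eventually_elim simp
  ultimately obtain \<eta> where \<eta>: "\<eta> \<in> fdom a" "section_abs M E \<eta> = f" "paired M E \<xi> \<eta>"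
    using dominated \<xi> f unfolding dominated_def generalized_ideal_def by blast
  define \<delta> where "\<delta> = vdiff (L2_sections M E) \<xi> \<eta>"
  have \<delta>: "\<delta> \<in> fdom a" using \<xi> \<eta> by (simp add: \<delta>_def A.dom.diff_closed)
  have pairing: "AE x in M. Re (vinner (fibre E x) (rep \<xi> x) (rep \<eta> x))
      = vnorm (fibre E x) (rep \<xi> x) * vnorm (fibre E x) (rep \<eta> x)"
    using \<eta>(3) paired_iff_AE \<xi> \<eta>(1) by (simp add: dom_in_L2_sections B.dom_in_L2 section_abs_in_dom)
  have rep_\<delta>: "AE x in M. rep \<delta> x = vdiff (fibre E x) (rep \<xi> x) (rep \<eta> x)"
    unfolding \<delta>_def using \<xi> \<eta>(1)
    by (intro sections.rep_diff dom_in_L2_sections A.dom.diff_closed A.dom.scale_closed)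
  \<comment> \<open>the bound \<open>|\<eta>| = f \<le> |\<xi>|\<close> fixes the sign of the square root\<close>
  have key: "AE x in M. vnorm (fibre E x) (rep \<delta> x) = vnorm (fibre E x) (rep \<xi> x) - vnorm (fibre E x) (rep \<eta> x)
      \<and> Re (vinner (fibre E x) (rep \<delta> x) (rep \<eta> x)) = vnorm (fibre E x) (rep \<delta> x) * vnorm (fibre E x) (rep \<eta> x)"
    using pairing rep_\<delta> f_le abs[OF \<eta>(1)] sections.AE_fibre[OF dom_in_L2_sections[OF \<xi>]]
      sections.AE_fibre[OF dom_in_L2_sections[OF \<eta>(1)]]
    unfolding \<eta>(2)
  proof eventually_elim
    case (elim x)
    then interpret Fx: complex_inner_space "fibre E x" by blast
    have in_fibre: "rep \<xi> x \<in> vecs (fibre E x)" "rep \<eta> x \<in> vecs (fibre E x)" using elim by auto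
    let ?s = "vnorm (fibre E x) (rep \<xi> x)" and ?t = "vnorm (fibre E x) (rep \<eta> x)"
    have "(vnorm (fibre E x) (rep \<delta> x))\<^sup>2 = (?s - ?t)\<^sup>2"
      using elim Fx.vnorm_diff_sq[OF in_fibre] by (simp add: power2_diff)
    moreover have "?t \<le> ?s" using elim by simp
    moreover have "0 \<le> vnorm (fibre E x) (rep \<delta> x)"
      using elim in_fibre by (simp add: Fx.vnorm_nonneg Fx.diff_closed)
    ultimately have n: "vnorm (fibre E x) (rep \<delta> x) = ?s - ?t" by simp
    have "Re (vinner (fibre E x) (rep \<delta> x) (rep \<eta> x)) = ?s * ?t - ?t\<^sup>2"
      using elim in_fibre by (simp add: Fx.inner_diff Fx.vnorm_sq)
    then show ?case unfolding n by (simp add: n power2_eq_square algebra_simps)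
  qed
  have "section_abs M E \<delta> = vdiff (L2 M) ?u f"
  proof (rule L2.class_eqI)
    show "section_abs M E \<delta> \<in> vecs (L2 M)" "vdiff (L2 M) ?u f \<in> vecs (L2 M)"
      using \<delta> u f by (simp_all add: B.dom_in_L2 section_abs_in_dom B.dom.diff_closed)
    have "AE x in M. rep (vdiff (L2 M) ?u f) x = vdiff complex_line (rep ?u x) (rep f x)"
      using u f by (intro L2.rep_diff B.dom_in_L2 B.dom.diff_closed B.dom.scale_closed)
    then show "AE x in M. rep (section_abs M E \<delta>) x = rep (vdiff (L2 M) ?u f) x"
      using abs[OF \<delta>] abs[OF \<xi>] abs[OF \<eta>(1)] key unfolding \<eta>(2)
      by eventually_elim (simp add: vdiff_complex_line)
  qed
  moreover have "paired M E \<delta> \<eta>"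
    using key \<delta> \<eta>(1) by (subst paired_iff_AE)
      (auto simp: dom_in_L2_sections B.dom_in_L2 section_abs_in_dom elim: eventually_mono)
  ultimately show ?thesis using that[OF \<eta>(1,2)] unfolding \<delta>_def by blast
qed

text \<open>
  In the inner product of the form \<open>a\<close>, \<open>\<parallel>\<eta>\<parallel>\<^sup>2 = Re \<langle>\<xi>, \<eta>\<rangle> - Re \<langle>\<xi> - \<eta>, \<eta>\<rangle>\<close>, and domination bounds the last
  term from below by \<open>Re b(w, f) + ma Re \<langle>w, f\<rangle>\<close>, where pairedness has turned the \<open>L\<^sup>2\<close> inner product of
  sections into one of functions. The summand with \<open>ma - mb\<close> arises because the two form norms are
  formed with different constants.
\<close>

lemma truncation_form_bound:
  assumes \<xi>: "\<xi> \<in> fdom a" and \<eta>: "\<eta> \<in> fdom a"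
    and abs: "section_abs M E (vdiff (L2_sections M E) \<xi> \<eta>) = w" "section_abs M E \<eta> = f"
    and paired: "paired M E (vdiff (L2_sections M E) \<xi> \<eta>) \<eta>"
  shows "(form_norm (L2_sections M E) a ma \<eta>)\<^sup>2
    \<le> form_norm (L2_sections M E) a ma \<xi> * form_norm (L2_sections M E) a ma \<eta>
      + (1 + \<bar>ma - mb\<bar> / (mb - lb)) * (form_norm (L2 M) b mb w * form_norm (L2 M) b mb f)"
proof -
  let ?A = "form_space (L2_sections M E) a ma" and ?B = "form_space (L2 M) b mb"
  let ?\<delta> = "vdiff (L2_sections M E) \<xi> \<eta>"
  have \<delta>: "?\<delta> \<in> fdom a" using \<xi> \<eta> by (rule A.dom.diff_closed)
  have w: "w \<in> fdom b" and f: "f \<in> fdom b"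
    using section_abs_in_dom[OF \<delta>] section_abs_in_dom[OF \<eta>] abs by simp_all
  have "Re (polar (L2 M) b w f) \<le> Re (polar (L2_sections M E) a ?\<delta> \<eta>)"
    using dominated \<delta> \<eta> paired unfolding dominated_def abs[symmetric] by blast
  moreover have "vinner (L2_sections M E) ?\<delta> \<eta> = vinner (L2 M) w f"
    using paired by (simp add: paired_def abs)
  moreover have "Re (vinner ?A ?\<delta> \<eta>) = Re (polar (L2_sections M E) a ?\<delta> \<eta>) + ma * Re (vinner (L2_sections M E) ?\<delta> \<eta>)"
    by (simp add: form_space_def)
  moreover have "Re (vinner ?B w f) = Re (polar (L2 M) b w f) + mb * Re (vinner (L2 M) w f)"
    by (simp add: form_space_def)
  ultimately have "Re (vinner ?B w f) + (ma - mb) * Re (vinner (L2 M) w f) \<le> Re (vinner ?A ?\<delta> \<eta>)"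
    by (simp add: algebra_simps)
  moreover have "- (vnorm ?B w * vnorm ?B f) \<le> Re (vinner ?B w f)"
    using B.form.Re_inner_le[OF w f] by simp
  moreover have "- (\<bar>ma - mb\<bar> / (mb - lb) * (vnorm ?B w * vnorm ?B f)) \<le> (ma - mb) * Re (vinner (L2 M) w f)"
  proof -
    have "\<bar>(ma - mb) * Re (vinner (L2 M) w f)\<bar> \<le> \<bar>ma - mb\<bar> * (vnorm (L2 M) w * vnorm (L2 M) f)"
      unfolding abs_mult using B.dom.Re_inner_le[OF w f] by (rule mult_left_mono) simp
    also have "\<dots> \<le> \<bar>ma - mb\<bar> * ((vnorm ?B w / sqrt (mb - lb)) * (vnorm ?B f / sqrt (mb - lb)))"
      using B.vnorm_le_form_norm[OF w] B.vnorm_le_form_norm[OF f] w f B.l_less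
      by (intro mult_left_mono mult_mono) (auto simp: B.form_norm_eq B.dom.vnorm_nonneg B.form.vnorm_nonneg)
    also have "\<dots> = \<bar>ma - mb\<bar> / (mb - lb) * (vnorm ?B w * vnorm ?B f)"
      using B.l_less by simp
    finally show ?thesis by linarith
  qed
  moreover have "Re (vinner ?A ?\<delta> \<eta>) = Re (vinner ?A \<xi> \<eta>) - (vnorm ?A \<eta>)\<^sup>2"
    using A.form.inner_diff[OF \<xi> \<eta> \<eta>] A.form.vnorm_sq[OF \<eta>] by simp
  moreover have "Re (vinner ?A \<xi> \<eta>) \<le> vnorm ?A \<xi> * vnorm ?A \<eta>"
    using A.form.Re_inner_le[OF \<xi> \<eta>] by simp
  ultimately have "(vnorm ?A \<eta>)\<^sup>2
      \<le> vnorm ?A \<xi> * vnorm ?A \<eta> + (1 + \<bar>ma - mb\<bar> / (mb - lb)) * (vnorm ?B w * vnorm ?B f)"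
    unfolding distrib_right by linarith
  then show ?thesis
    using \<xi> \<eta> w f by (simp add: A.form_norm_eq B.form_norm_eq)
qed

text \<open>
  The section to use is the truncation of \<open>\<xi>\<close> by \<open>f = min |g| |\<xi>|\<close>. The assumption \<open>near\<close> bounds the form norm
  of \<open>g\<close> by \<open>N + 1\<close>, where \<open>N\<close> is that of \<open>|\<xi>|\<close>; hence \<open>f\<close> has form norm at most \<open>2 N + 1\<close> and \<open>|\<xi>| - f\<close> at
  most \<open>3 N + 1\<close>. The resulting bound is the same for all such \<open>g\<close>.
\<close>

lemma compact_truncation:
  assumes \<xi>: "\<xi> \<in> fdom a" and g: "g \<in> fdom b" "g \<in> L2_compact X M"
    and near: "form_norm (L2 M) b mb (vdiff (L2 M) (section_abs M E \<xi>) g) < 1"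
  obtains \<eta> where "\<eta> \<in> fdom a" "\<eta> \<in> L2_sections_compact X M E"
    "vnorm (L2_sections M E) (vdiff (L2_sections M E) \<xi> \<eta>) \<le> vnorm (L2 M) (vdiff (L2 M) (section_abs M E \<xi>) g)"
    "form_norm (L2_sections M E) a ma \<eta> \<le> form_norm (L2_sections M E) a ma \<xi>
      + sqrt ((1 + \<bar>ma - mb\<bar> / (mb - lb)) *
        ((3 * form_norm (L2 M) b mb (section_abs M E \<xi>) + 1) * (2 * form_norm (L2 M) b mb (section_abs M E \<xi>) + 1)))"
proof -
  let ?u = "section_abs M E \<xi>" and ?N = "form_norm (L2 M) b mb"
  have u: "?u \<in> fdom b" by (rule section_abs_in_dom[OF \<xi>])
  have abs: "AE x in M. rep (section_abs M E \<zeta>) x = of_real (vnorm (fibre E x) (rep \<zeta> x))"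
    if "\<zeta> \<in> fdom a" for \<zeta>
    by (rule rep_section_abs[OF B.dom_in_L2[OF section_abs_in_dom[OF that]]])
  note fibre_\<xi> = sections.AE_fibre[OF dom_in_L2_sections[OF \<xi>]]
  obtain f where f: "f \<in> fdom b"
    and rep_f: "AE x in M. rep f x = of_real (min (cmod (rep g x)) (cmod (rep ?u x)))"
    and Nf: "?N f \<le> ?N g + ?N ?u"
    using B.min_abs_in_domain[OF u g(1)] .
  have "AE x in M. Im (rep f x) = 0 \<and> 0 \<le> Re (rep f x) \<and> Re (rep f x) \<le> vnorm (fibre E x) (rep \<xi> x)"
    using rep_f abs[OF \<xi>] fibre_\<xi>
    by eventually_elim (auto simp: complex_inner_space.vnorm_nonneg)
  then obtain \<eta> where \<eta>: "\<eta> \<in> fdom a" "section_abs M E \<eta> = f"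
    and abs_diff: "section_abs M E (vdiff (L2_sections M E) \<xi> \<eta>) = vdiff (L2 M) ?u f"
    and paired: "paired M E (vdiff (L2_sections M E) \<xi> \<eta>) \<eta>"
    using truncation[OF \<xi> f] by blast
  have \<delta>: "vdiff (L2_sections M E) \<xi> \<eta> \<in> fdom a" using \<xi> \<eta>(1) by (rule A.dom.diff_closed)
  have ug: "vdiff (L2 M) ?u g \<in> fdom b" and uf: "vdiff (L2 M) ?u f \<in> fdom b"
    using u g(1) f by (simp_all add: B.dom.diff_closed)
  have nonneg: "0 \<le> ?N v" if "v \<in> fdom b" for v
    using that by (simp add: B.form_norm_eq B.form.vnorm_nonneg)

  have compact: "\<eta> \<in> L2_sections_compact X M E"
  proof -
    obtain K g0 where K: "compactin X K" and g0: "g0 \<in> g"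
      and off: "\<And>x. x \<in> topspace X - K \<Longrightarrow> g0 x = 0"
      using g(2) unfolding L2_compact_def by blast
    note g0S = L2.mem_classD[OF B.dom_in_L2[OF g(1)] g0]
    let ?Z = "{x \<in> space M. g0 x = 0}"
    have "g0 \<in> borel_measurable M" using g0S(1) by (simp add: sq_integrable_functions_def)
    then have "?Z \<in> sets M" by measurable
    moreover have "topspace X - K \<subseteq> ?Z" using off space_eq_topspace[OF sets_M] by auto
    moreover have "AE x in M. x \<in> ?Z \<longrightarrow> rep \<eta> x = vzero (fibre E x)"
      using g0S(2) rep_f abs[OF \<eta>(1)] sections.AE_fibre[OF dom_in_L2_sections[OF \<eta>(1)]]
      unfolding \<eta>(2)
    proof eventually_elim
      case (elim x)
      then interpret Fx: complex_inner_space "fibre E x" by blast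
      have "vnorm (fibre E x) (rep \<eta> x) = 0" if "x \<in> ?Z"
      proof -
        have "rep g x = 0" using that elim by simp
        then have "complex_of_real (vnorm (fibre E x) (rep \<eta> x)) = 0" using elim by simp
        then show ?thesis by simp
      qed
      then show ?case using elim Fx.vnorm_eq_zero by simp
    qed
    ultimately show ?thesis
      using K compact_support_iff[OF dom_in_L2_sections[OF \<eta>(1)]] by blast
  qed

  have close: "vnorm (L2_sections M E) (vdiff (L2_sections M E) \<xi> \<eta>) \<le> vnorm (L2 M) (vdiff (L2 M) ?u g)"
  proof -
    have "AE x in M. (vnorm (fibre E x) (rep (vdiff (L2_sections M E) \<xi> \<eta>) x))\<^sup>2
        \<le> (vnorm complex_line (rep (vdiff (L2 M) ?u g) x))\<^sup>2"
      using abs[OF \<delta>] abs[OF \<xi>] rep_f fibre_\<xi>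
        L2.rep_diff[OF B.dom_in_L2[OF uf] B.dom_in_L2[OF B.dom.scale_closed[OF f]]]
        L2.rep_diff[OF B.dom_in_L2[OF ug] B.dom_in_L2[OF B.dom.scale_closed[OF g(1)]]]
      unfolding abs_diff
    proof eventually_elim
      case (elim x)
      then interpret Fx: complex_inner_space "fibre E x" by blast
      let ?s = "vnorm (fibre E x) (rep \<xi> x)"
      have s: "0 \<le> ?s" using elim by (intro Fx.vnorm_nonneg) blast
      have "complex_of_real (vnorm (fibre E x) (rep (vdiff (L2_sections M E) \<xi> \<eta>) x))
          = of_real (?s - min (cmod (rep g x)) ?s)"
        using elim s by (simp add: vdiff_complex_line)
      then have eq: "vnorm (fibre E x) (rep (vdiff (L2_sections M E) \<xi> \<eta>) x) = ?s - min (cmod (rep g x)) ?s"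
        by (simp only: of_real_eq_iff)
      have "?s - cmod (rep g x) \<le> cmod (of_real ?s - rep g x)"
        using norm_triangle_ineq2[of "complex_of_real ?s" "rep g x"] s by simp
      then have "?s - min (cmod (rep g x)) ?s \<le> cmod (of_real ?s - rep g x)"
        by (simp add: min_def)
      then show ?case
        using elim unfolding eq by (simp add: vnorm_complex_line vdiff_complex_line power_mono)
    qed
    then have "(\<integral>x. (vnorm (fibre E x) (rep (vdiff (L2_sections M E) \<xi> \<eta>) x))\<^sup>2 \<partial>M)
        \<le> (\<integral>x. (vnorm complex_line (rep (vdiff (L2 M) ?u g) x))\<^sup>2 \<partial>M)"
      by (intro integral_mono_AE sections.norm_sq_integrable sections.rep_in_S L2.norm_sq_integrable
          L2.rep_in_S dom_in_L2_sections \<delta> B.dom_in_L2 ug)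
    then show ?thesis
      by (simp add: sections.vnorm_class L2.vnorm_class dom_in_L2_sections \<delta> B.dom_in_L2 ug)
  qed

  let ?N\<^sub>a = "form_norm (L2_sections M E) a ma" and ?c = "1 + \<bar>ma - mb\<bar> / (mb - lb)"
  have "?N\<^sub>a \<eta> \<le> ?N\<^sub>a \<xi> + sqrt (?c * ((3 * ?N ?u + 1) * (2 * ?N ?u + 1)))"
  proof (rule le_add_sqrt_if_square_le)
    have c: "0 \<le> ?c" using B.l_less by simp
    have "?N g \<le> ?N ?u + 1"
      using B.form.vnorm_le_add_diff[OF u g(1)] near u g(1) ug by (simp add: B.form_norm_eq)
    then have "?N f \<le> 2 * ?N ?u + 1" using Nf by simp
    moreover have "?N (vdiff (L2 M) ?u f) \<le> ?N ?u + ?N f"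
      using B.form.vnorm_triangle_diff[OF u f] u f uf by (simp add: B.form_norm_eq)
    ultimately have "?N (vdiff (L2 M) ?u f) * ?N f \<le> (3 * ?N ?u + 1) * (2 * ?N ?u + 1)"
      using nonneg[OF u] nonneg[OF f] nonneg[OF uf] by (intro mult_mono) linarith+
    then have "?c * (?N (vdiff (L2 M) ?u f) * ?N f) \<le> ?c * ((3 * ?N ?u + 1) * (2 * ?N ?u + 1))"
      using c by (rule mult_left_mono)
    then show "(?N\<^sub>a \<eta>)\<^sup>2 \<le> ?N\<^sub>a \<xi> * ?N\<^sub>a \<eta> + ?c * ((3 * ?N ?u + 1) * (2 * ?N ?u + 1))"
      using truncation_form_bound[OF \<xi> \<eta>(1) abs_diff \<eta>(2) paired] by linarith
    show "0 \<le> ?N\<^sub>a \<xi>" using \<xi> by (simp add: A.form_norm_eq A.form.vnorm_nonneg)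
    show "0 \<le> ?c * ((3 * ?N ?u + 1) * (2 * ?N ?u + 1))"
      using c nonneg[OF u] by simp
  qed
  then show ?thesis using that \<eta>(1) compact close by blast
qed

theorem compact_sections_core:
  assumes core: "form_core (L2 M) b mb (fdom b \<inter> L2_compact X M)"
  shows "form_core (L2_sections M E) a ma (fdom a \<inter> L2_sections_compact X M E)"
proof -
  let ?S = "fdom a \<inter> L2_sections_compact X M E"
  have S: "linear_subspace (L2_sections M E) ?S"
    by (rule linear_subspace_compact_support[OF A.dom_subspace])
  have "\<exists>\<eta>\<in>?S. form_norm (L2_sections M E) a ma (vdiff (L2_sections M E) \<xi> \<eta>) < \<epsilon>"
    if \<xi>: "\<xi> \<in> fdom a" and \<epsilon>: "\<epsilon> > 0" for \<xi> \<epsilon>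
  proof (rule A.approximation_from_bounded[OF S _ \<xi> _ \<epsilon>])
    let ?u = "section_abs M E \<xi>"
    show "\<exists>\<eta>\<in>?S. vnorm (L2_sections M E) (vdiff (L2_sections M E) \<xi> \<eta>) < \<epsilon>'
      \<and> form_norm (L2_sections M E) a ma \<eta> \<le> form_norm (L2_sections M E) a ma \<xi>
        + sqrt ((1 + \<bar>ma - mb\<bar> / (mb - lb)) *
          ((3 * form_norm (L2 M) b mb ?u + 1) * (2 * form_norm (L2 M) b mb ?u + 1)))"
      if "\<epsilon>' > 0" for \<epsilon>'
    proof -
      have u: "?u \<in> fdom b" by (rule section_abs_in_dom[OF \<xi>])
      have "0 < min 1 (\<epsilon>' * sqrt (mb - lb))" using that B.l_less by simp
      then obtain g where g: "g \<in> fdom b" "g \<in> L2_compact X M"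
        and near: "form_norm (L2 M) b mb (vdiff (L2 M) ?u g) < min 1 (\<epsilon>' * sqrt (mb - lb))"
        using core u unfolding form_core_def by blast
      have "vnorm (L2 M) (vdiff (L2 M) ?u g) \<le> form_norm (L2 M) b mb (vdiff (L2 M) ?u g) / sqrt (mb - lb)"
        using u g(1) by (intro B.vnorm_le_form_norm B.dom.diff_closed)
      also have "\<dots> < \<epsilon>'" using near B.l_less by (simp add: pos_divide_less_eq)
      finally have small: "vnorm (L2 M) (vdiff (L2 M) ?u g) < \<epsilon>'" .
      have "form_norm (L2 M) b mb (vdiff (L2 M) ?u g) < 1" using near by simp
      from compact_truncation[OF \<xi> g this] show ?thesis
        using le_less_trans[OF _ small] by (metis IntI)
    qed
  qed blast
  then show ?thesis using S unfolding form_core_def by blast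
qed

end

theorem corollary2p4:
  fixes X :: "'x topology" and M :: "'x measure"
    and E :: "('x, 'e) vbundle" and H :: "'h inner_structure"
    and a :: "('x \<Rightarrow> 'e) set qform" and b :: "('x \<Rightarrow> complex) set qform"
    and ma mb :: real
  assumes "Lindelof_space X"
    and "sets M = sets (borel_of X)"
    and "hermitian_vector_bundle X E H"
    and "closed_form (L2 M) b mb"
    and "first_Beurling_Deny M b"
    and "closed_form (L2_sections M E) a ma"
    and "dominated M E a b"
    and "form_core (L2 M) b mb (fdom b \<inter> L2_compact X M)"
  shows "form_core (L2_sections M E) a ma (fdom a \<inter> L2_sections_compact X M E)"
proof -
  interpret bundle_L2 X E H M
    using assms(1-3) by (simp add: bundle_L2_def bundle_L2_axioms_def)
  obtain la lb where l: "la < ma" "lower_bound (L2_sections M E) a la"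
    "lb < mb" "lower_bound (L2 M) b lb"
    using assms(4,6) unfolding closed_form_def by blast
  have "complex_inner_space (L2_sections M E\<lparr>vecs := fdom a\<rparr>)"
    by (rule sections.complex_inner_space_class)
      (use assms(6) in \<open>simp add: closed_form_def quadratic_form_def\<close>)
  moreover have "complex_inner_space (L2 M\<lparr>vecs := fdom b\<rparr>)"
    by (rule L2.complex_inner_space_class)
      (use assms(4) in \<open>simp add: closed_form_def quadratic_form_def\<close>)
  ultimately have inner: "complex_inner_space (L2_sections M E\<lparr>vecs := fdom a\<rparr>)"
    "complex_inner_space (L2 M\<lparr>vecs := fdom b\<rparr>)" .
  interpret A: closed_form_space "L2_sections M E" a ma la
    by (rule closed_form_space.intro[OF inner(1) assms(6) l(2,1)])
  interpret B: closed_form_space "L2 M" b mb lb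
    by (rule closed_form_space.intro[OF inner(2) assms(4) l(4,3)])
  interpret dominated_forms X E H M a b ma la mb lb
    by unfold_locales (rule assms)+
  show ?thesis by (rule compact_sections_core[OF assms(8)])
qed


end
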